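(* Let $k,l$ be nonnegative integers, not both $0$, let $z',w'\in\mathbb C$, and put $z=k$, $w=l$. Then the differential operator $\mathbb D_{z,z',w,w'}$ on $R$ preserves the ideal $J(k,-l)\subset R$ and so determines an operator on $R/J(k,-l)=\widehat R(k,-l)$. Under the identification of $\widehat R(k,-l)$ with the algebra of symmetric polynomials in $m=k+l$ variables $t_1,\dots,t_m$, the latter operator coincides with the $(k+l)$-variate Jacobi operator $$D^{(a,b)}_m=\sum_{i=1}^m\left(t_i(1-t_i)\frac{\partial^2}{\partial t_i^2}+\left[b+1-(a+b+2)t_i+\sum_{j:\,j\ne i}\frac{2t_i(1-t_i)}{t_i-t_j}\right]\frac{\partial}{\partial t_i}\right)$$ with parameters $a=z'-k$, $b=w'-l$.
   Context: Let $\varphi_n$, $n\in\mathbb Z$, be commuting formal variables of degree $1$. $R=\bigoplus_{N\ge0}R_N$ is the commutative graded complex algebra of formal power series of bounded degree in the $\varphi_n$; $R_N$ consists of all formal (possibly infinite) sums $\sum_{n_1\ge\dots\ge n_N}a_{n_1,\dots,n_N}\varphi_{n_1}\cdots\varphi_{n_N}$ with arbitrary complex coefficients. For $(z,z',w,w')\in\mathbb C^4$, $$\mathbb D_{z,z',w,w'}=\sum_{n\in\mathbb Z}A_{nn}\frac{\partial^2}{\partial\varphi_n^2}+2\sum_{n_1>n_2}A_{n_1n_2}\frac{\partial^2}{\partial\varphi_{n_1}\partial\varphi_{n_2}}+\sum_{n\in\mathbb Z}B_n\frac{\partial}{\partial\varphi_n},$$ where for $n_1\ge n_2$ $$A_{n_1n_2}=\sum_{p=0}^\infty(n_1-n_2+2p+1)(\varphi_{n_1+p+1}\varphi_{n_2-p}+\varphi_{n_1+p}\varphi_{n_2-p-1})-(n_1-n_2)\varphi_{n_1}\varphi_{n_2}-2\sum_{p=1}^\infty(n_1-n_2+2p)\varphi_{n_1+p}\varphi_{n_2-p},$$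 $$B_n=(n+w+1)(n+w'+1)\varphi_{n+1}+(n-z-1)(n-z'-1)\varphi_{n-1}-\big((n-z)(n-z')+(n+w)(n+w')\big)\varphi_n.$$ It is a well-defined linear operator $R\to R$ (acting termwise on formal series). $J(k,-l)\subset R$ is the ideal generated by $\varphi_{-l}+\dots+\varphi_k-1$ together with the kernel $I(k,-l)$ of the truncation homomorphism $R\to\mathbb C[\varphi_{-l},\dots,\varphi_k]$ (which sets $\varphi_n=0$ for $n>k$ and $n<-l$). Thus $R/J(k,-l)$ is the algebra $\widehat R(k,-l)=\mathbb C[\varphi_{-l},\dots,\varphi_k]/(\varphi_{-l}+\dots+\varphi_k-1)$. It is identified with the algebra of symmetric polynomials in $t_1,\dots,t_m$, $m=k+l$, by expressing the $\varphi_n$ through the $t_i$ via $$\sum_{n=-l}^k\varphi_nu^n=\prod_{i=1}^k(t_i+(1-t_i)u)\cdot\prod_{i=k+1}^m(1-t_i+t_iu^{-1}),$$ $u$ being an auxiliary indeterminate. The operator $D^{(a,b)}_m$ maps symmetric polynomials to symmetric polynomials despite the singularities at $t_i=t_j$. *)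

theory Defs
  imports
    Complex_Main
    "HOL-Library.Poly_Mapping"
    "HOL-Computational_Algebra.Polynomial_Factorial"
    "HOL-Combinatorics.Permutations"
    "HOL-Algebra.QuotRing"
begin

section \<open>Polynomials\<close>

type_synonym 'v monom = "'v \<Rightarrow>\<^sub>0 nat"
type_synonym 'v mpoly = "'v monom \<Rightarrow>\<^sub>0 complex"

text \<open>
  A monomial is a finitely supported exponent function, and a polynomial is a finitely supported
  coefficient function on monomials; \<^typ>\<open>'v mpoly\<close> carries the ring structure of
  \<^theory>\<open>HOL-Library.Poly_Mapping\<close>.
\<close>

definition mono_var :: "'v \<Rightarrow> 'v monom" where
  "mono_var v = Poly_Mapping.single v 1"

definition mono_deg :: "'v monom \<Rightarrow> nat" where
  "mono_deg M = (\<Sum>v\<in>Poly_Mapping.keys M. Poly_Mapping.lookup M v)"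

lemma keys_add_monom: "Poly_Mapping.keys (P + Q) = Poly_Mapping.keys P \<union> Poly_Mapping.keys (Q :: 'v monom)"
  by (auto simp: in_keys_iff lookup_add)

lemma mono_deg_add: "mono_deg (P + Q) = mono_deg P + mono_deg Q"
proof -
  have *: "mono_deg R = (\<Sum>v\<in>Poly_Mapping.keys (P + Q). Poly_Mapping.lookup R v)"
    if "Poly_Mapping.keys R \<subseteq> Poly_Mapping.keys (P + Q)" for R
    unfolding mono_deg_def using that by (intro sum.mono_neutral_left) (auto simp: in_keys_iff)
  show ?thesis
    by (subst (1 2 3) *) (auto simp: keys_add_monom lookup_add sum.distrib)
qed

lemma mono_deg_var [simp]: "mono_deg (mono_var v) = 1"
  by (simp add: mono_deg_def mono_var_def)

lemma keys_mono_var [simp]: "Poly_Mapping.keys (mono_var v) = {v}"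
  by (simp add: mono_var_def)

lemma finite_monom_bounded:
  assumes "finite V"
  shows "finite {M :: 'v monom. Poly_Mapping.keys M \<subseteq> V \<and> (\<forall>v. Poly_Mapping.lookup M v \<le> N v)}"
proof (rule finite_imageD)
  let ?S = "{M :: 'v monom. Poly_Mapping.keys M \<subseteq> V \<and> (\<forall>v. Poly_Mapping.lookup M v \<le> N v)}"
  have "Poly_Mapping.lookup ` ?S \<subseteq> {f. \<forall>v. (v \<in> V \<longrightarrow> f v \<in> (\<Union>v\<in>V. {..N v})) \<and> (v \<notin> V \<longrightarrow> f v = 0)}"
    by (auto simp: in_keys_iff)
  moreover have "finite \<dots>"
    using assms by (intro finite_set_of_finite_funs) auto
  ultimately show "finite (Poly_Mapping.lookup ` ?S)"
    by (rule finite_subset)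
  show "inj_on Poly_Mapping.lookup ?S"
    by (auto intro: inj_onI poly_mapping_eqI)
qed

lemma finite_splits: "finite {(P, Q). P + Q = (M :: 'v monom)}"
proof -
  let ?S = "{P :: 'v monom. Poly_Mapping.keys P \<subseteq> Poly_Mapping.keys M \<and>
    (\<forall>v. Poly_Mapping.lookup P v \<le> Poly_Mapping.lookup M v)}"
  have "{(P, Q). P + Q = M} \<subseteq> ?S \<times> ?S"
    by (auto simp: keys_add_monom lookup_add)
  moreover have "finite (?S \<times> ?S)"
    by (intro finite_cartesian_product finite_monom_bounded) auto
  ultimately show ?thesis
    by (rule finite_subset)
qed

definition pconst :: "complex \<Rightarrow> 'v mpoly" where
  "pconst c = Poly_Mapping.single 0 c"

definition pvar :: "'v \<Rightarrow> 'v mpoly" where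
  "pvar v = Poly_Mapping.single (mono_var v) 1"

definition psubst :: "('v \<Rightarrow> 'u mpoly) \<Rightarrow> 'v mpoly \<Rightarrow> 'u mpoly" where
  "psubst g p = (\<Sum>M\<in>Poly_Mapping.keys p. pconst (Poly_Mapping.lookup p M) *
     (\<Prod>v\<in>Poly_Mapping.keys M. g v ^ Poly_Mapping.lookup M v))"

text \<open>In the partial derivative the truncated subtraction is harmless: if \<open>v\<close> does not occur in
  \<open>M\<close>, the coefficient vanishes.\<close>

definition pderivative :: "'v \<Rightarrow> 'v mpoly \<Rightarrow> 'v mpoly" where
  "pderivative v p = (\<Sum>M\<in>Poly_Mapping.keys p.
     Poly_Mapping.single (M - mono_var v)
       (of_nat (Poly_Mapping.lookup M v) * Poly_Mapping.lookup p M))"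

definition mpoly_ring :: "'v set \<Rightarrow> 'v mpoly ring" where
  "mpoly_ring V = \<lparr>carrier = {p. \<forall>M\<in>Poly_Mapping.keys p. Poly_Mapping.keys M \<subseteq> V},
     mult = (*), one = 1, zero = 0, add = (+)\<rparr>"

definition sym_ring :: "nat \<Rightarrow> nat mpoly ring" where
  "sym_ring m = (mpoly_ring {1..m})\<lparr>carrier :=
     {p \<in> carrier (mpoly_ring {1..m}).
        \<forall>\<sigma>. \<sigma> permutes {1..m} \<longrightarrow> psubst (\<lambda>i. pvar (\<sigma> i)) p = p}\<rparr>"


section \<open>The algebra of formal power series of bounded degree\<close>

type_synonym phi_series = "int monom \<Rightarrow> complex"

definition phi_ring :: "phi_series ring" where
  "phi_ring = \<lparr>carrier = {f. \<exists>N. \<forall>M. mono_deg M > N \<longrightarrow> f M = 0},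
     mult = (\<lambda>f g M. \<Sum>(P, Q) | P + Q = M. f P * g Q),
     one = (\<lambda>M. if M = 0 then 1 else 0),
     zero = (\<lambda>M. 0),
     add = (\<lambda>f g M. f M + g M)\<rparr>"

lemma phi_ring_simps:
  "f \<in> carrier phi_ring \<longleftrightarrow> (\<exists>N. \<forall>M. mono_deg M > N \<longrightarrow> f M = 0)"
  "(f \<otimes>\<^bsub>phi_ring\<^esub> g) M = (\<Sum>(P, Q) | P + Q = M. f P * g Q)"
  "\<one>\<^bsub>phi_ring\<^esub> M = (if M = 0 then 1 else 0)"
  "\<zero>\<^bsub>phi_ring\<^esub> M = 0"
  "(f \<oplus>\<^bsub>phi_ring\<^esub> g) M = f M + g M"
  by (auto simp: phi_ring_def)

lemma phi_mult_nonzeroE: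
  assumes "(f \<otimes>\<^bsub>phi_ring\<^esub> g) M \<noteq> 0"
  obtains P Q where "P + Q = M" "f P \<noteq> 0" "g Q \<noteq> 0"
proof -
  have "\<exists>x\<in>{(P, Q). P + Q = M}. (case x of (P, Q) \<Rightarrow> f P * g Q) \<noteq> 0"
    using assms unfolding phi_ring_simps by (meson sum.neutral)
  thus ?thesis using that by auto
qed

lemma phi_mult_assoc:
  "(f \<otimes>\<^bsub>phi_ring\<^esub> g) \<otimes>\<^bsub>phi_ring\<^esub> h = f \<otimes>\<^bsub>phi_ring\<^esub> (g \<otimes>\<^bsub>phi_ring\<^esub> h)"
proof
  fix M
  let ?S = "\<lambda>M::int monom. {(P, Q). P + Q = M}"
  have "((f \<otimes>\<^bsub>phi_ring\<^esub> g) \<otimes>\<^bsub>phi_ring\<^esub> h) M =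
      (\<Sum>x\<in>?S M. \<Sum>y\<in>?S (fst x). f (fst y) * g (snd y) * h (snd x))"
    by (simp add: phi_ring_simps sum_distrib_right case_prod_unfold)
  also have "\<dots> = (\<Sum>(x, y)\<in>(SIGMA x:?S M. ?S (fst x)). f (fst y) * g (snd y) * h (snd x))"
    by (subst sum.Sigma) (auto simp: finite_splits)
  also have "\<dots> = (\<Sum>(x, y)\<in>(SIGMA x:?S M. ?S (snd x)). f (fst x) * (g (fst y) * h (snd y)))"
    by (rule sum.reindex_bij_witness[where
          i = "\<lambda>(x, y). ((fst x + fst y, snd y), (fst x, fst y))" and
          j = "\<lambda>(x, y). ((fst y, snd y + snd x), (snd y, snd x))"])
       (auto simp: add.assoc mult.assoc)
  also have "\<dots> = (\<Sum>x\<in>?S M. \<Sum>y\<in>?S (snd x). f (fst x) * (g (fst y) * h (snd y)))"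
    by (subst sum.Sigma) (auto simp: finite_splits)
  also have "\<dots> = (f \<otimes>\<^bsub>phi_ring\<^esub> (g \<otimes>\<^bsub>phi_ring\<^esub> h)) M"
    by (simp add: phi_ring_simps sum_distrib_left case_prod_unfold)
  finally show "((f \<otimes>\<^bsub>phi_ring\<^esub> g) \<otimes>\<^bsub>phi_ring\<^esub> h) M = (f \<otimes>\<^bsub>phi_ring\<^esub> (g \<otimes>\<^bsub>phi_ring\<^esub> h)) M" .
qed

lemma phi_mult_comm: "f \<otimes>\<^bsub>phi_ring\<^esub> g = g \<otimes>\<^bsub>phi_ring\<^esub> f"
proof
  fix M
  show "(f \<otimes>\<^bsub>phi_ring\<^esub> g) M = (g \<otimes>\<^bsub>phi_ring\<^esub> f) M"
    unfolding phi_ring_simps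
    by (rule sum.reindex_bij_witness[where i = prod.swap and j = prod.swap])
       (auto simp: add.commute mult.commute)
qed

lemma phi_mult_one: "\<one>\<^bsub>phi_ring\<^esub> \<otimes>\<^bsub>phi_ring\<^esub> f = f"
proof
  fix M
  have "(\<one>\<^bsub>phi_ring\<^esub> \<otimes>\<^bsub>phi_ring\<^esub> f) M = (\<Sum>(P, Q)\<in>{(0 :: int monom, M)}. (if P = 0 then 1 else 0) * f Q)"
    unfolding phi_ring_simps by (rule sum.mono_neutral_right) (auto simp: finite_splits split: if_splits)
  thus "(\<one>\<^bsub>phi_ring\<^esub> \<otimes>\<^bsub>phi_ring\<^esub> f) M = f M" by simp
qed

lemma phi_mult_closed:
  assumes "f \<in> carrier phi_ring" "g \<in> carrier phi_ring"
  shows "f \<otimes>\<^bsub>phi_ring\<^esub> g \<in> carrier phi_ring"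
proof -
  obtain m n where mn: "\<And>M. mono_deg M > m \<Longrightarrow> f M = 0" "\<And>M. mono_deg M > n \<Longrightarrow> g M = 0"
    using assms by (auto simp: phi_ring_simps)
  have "(f \<otimes>\<^bsub>phi_ring\<^esub> g) M = 0" if "mono_deg M > m + n" for M
  proof (rule ccontr)
    assume "(f \<otimes>\<^bsub>phi_ring\<^esub> g) M \<noteq> 0"
    then obtain P Q where "P + Q = M" "f P \<noteq> 0" "g Q \<noteq> 0"
      by (rule phi_mult_nonzeroE)
    moreover from this have "mono_deg P \<le> m" "mono_deg Q \<le> n"
      using mn by (meson not_le)+
    ultimately show False
      using that by (auto simp: mono_deg_add)
  qed
  thus ?thesis unfolding phi_ring_simps by blast
qed

lemma phi_add_closed:
  assumes "f \<in> carrier phi_ring" "g \<in> carrier phi_ring"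
  shows "f \<oplus>\<^bsub>phi_ring\<^esub> g \<in> carrier phi_ring"
proof -
  obtain m n where "\<And>M. mono_deg M > m \<Longrightarrow> f M = 0" "\<And>M. mono_deg M > n \<Longrightarrow> g M = 0"
    using assms by (auto simp: phi_ring_simps)
  hence "\<forall>M. mono_deg M > max m n \<longrightarrow> (f \<oplus>\<^bsub>phi_ring\<^esub> g) M = 0"
    by (simp add: phi_ring_simps)
  thus ?thesis unfolding phi_ring_simps(1) by blast
qed

lemma cring_phi_ring: "cring phi_ring"
proof (rule cringI)
  show "abelian_group phi_ring"
  proof (rule abelian_groupI)
    fix f assume f: "f \<in> carrier phi_ring"
    show "\<exists>g\<in>carrier phi_ring. g \<oplus>\<^bsub>phi_ring\<^esub> f = \<zero>\<^bsub>phi_ring\<^esub>"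
      using f by (intro bexI[of _ "\<lambda>M. - f M"]) (auto simp: phi_ring_simps fun_eq_iff)
  next
    show "\<zero>\<^bsub>phi_ring\<^esub> \<in> carrier phi_ring"
      by (simp add: phi_ring_simps)
  qed (auto simp: phi_add_closed phi_ring_simps(2-5) fun_eq_iff)
  have "\<forall>M. mono_deg M > 0 \<longrightarrow> \<one>\<^bsub>phi_ring\<^esub> M = 0"
    by (auto simp: phi_ring_simps mono_deg_def)
  hence "\<one>\<^bsub>phi_ring\<^esub> \<in> carrier phi_ring"
    unfolding phi_ring_simps(1) by blast
  thus "comm_monoid phi_ring"
    by (intro comm_monoidI phi_mult_closed phi_mult_assoc phi_mult_one phi_mult_comm) auto
  show "(f \<oplus>\<^bsub>phi_ring\<^esub> g) \<otimes>\<^bsub>phi_ring\<^esub> h =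
      f \<otimes>\<^bsub>phi_ring\<^esub> h \<oplus>\<^bsub>phi_ring\<^esub> g \<otimes>\<^bsub>phi_ring\<^esub> h" for f g h
    by (simp add: fun_eq_iff phi_ring_simps case_prod_unfold ring_distribs sum.distrib)
qed

definition phi :: "int \<Rightarrow> phi_series" where
  "phi n = (\<lambda>M. if M = mono_var n then 1 else 0)"

definition phi_deriv :: "int \<Rightarrow> phi_series \<Rightarrow> phi_series" where
  "phi_deriv n f = (\<lambda>M. of_nat (Poly_Mapping.lookup M n + 1) * f (M + mono_var n))"


section \<open>The operator $\mathbb{D}$\<close>

text \<open>
  Infinite formal sums are taken coefficientwise. \<^const>\<open>sum'\<close> is the sum over the finite set of
  nonzero summands; the lemmas \<open>finite_coeffA\<close> and \<open>finite_opD\<close> below show that this set is finite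
  in every instance that occurs.
\<close>

definition coeffA :: "int \<Rightarrow> int \<Rightarrow> phi_series" where
  "coeffA n1 n2 = (\<lambda>M.
     sum' (\<lambda>p::nat. of_int (n1 - n2 + 2 * int p + 1) *
         ((phi (n1 + int p + 1) \<otimes>\<^bsub>phi_ring\<^esub> phi (n2 - int p)) M +
          (phi (n1 + int p) \<otimes>\<^bsub>phi_ring\<^esub> phi (n2 - int p - 1)) M)) UNIV
     - of_int (n1 - n2) * (phi n1 \<otimes>\<^bsub>phi_ring\<^esub> phi n2) M
     - 2 * sum' (\<lambda>p::nat. of_int (n1 - n2 + 2 * int p) *
         (phi (n1 + int p) \<otimes>\<^bsub>phi_ring\<^esub> phi (n2 - int p)) M) {1..})"

definition coeffB :: "complex \<Rightarrow> complex \<Rightarrow> complex \<Rightarrow> complex \<Rightarrow> int \<Rightarrow> phi_series" where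
  "coeffB z z' w w' n = (\<lambda>M.
     (of_int n + w + 1) * (of_int n + w' + 1) * phi (n + 1) M
     + (of_int n - z - 1) * (of_int n - z' - 1) * phi (n - 1) M
     - ((of_int n - z) * (of_int n - z') + (of_int n + w) * (of_int n + w')) * phi n M)"

definition opD :: "complex \<Rightarrow> complex \<Rightarrow> complex \<Rightarrow> complex \<Rightarrow> phi_series \<Rightarrow> phi_series" where
  "opD z z' w w' f = (\<lambda>M.
     sum' (\<lambda>n. (coeffA n n \<otimes>\<^bsub>phi_ring\<^esub> phi_deriv n (phi_deriv n f)) M) UNIV
     + 2 * sum' (\<lambda>(n1, n2). (coeffA n1 n2 \<otimes>\<^bsub>phi_ring\<^esub> phi_deriv n1 (phi_deriv n2 f)) M)
         {(n1, n2). n1 > n2}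
     + sum' (\<lambda>n. (coeffB z z' w w' n \<otimes>\<^bsub>phi_ring\<^esub> phi_deriv n f) M) UNIV)"

lemma phi_mult_phi_nonzero:
  assumes "(phi a \<otimes>\<^bsub>phi_ring\<^esub> phi b) M \<noteq> 0"
  shows "M = mono_var a + mono_var b"
  using assms by (elim phi_mult_nonzeroE) (auto simp: phi_def split: if_splits)

lemma sum'_nonzeroE:
  assumes "sum' F S \<noteq> (0 :: 'a :: comm_monoid_add)"
  obtains i where "i \<in> S" "F i \<noteq> 0"
proof -
  have "{i \<in> S. F i \<noteq> 0} \<noteq> {}"
    using assms by (auto simp: sum.G_def simp del: Collect_empty_eq)
  thus ?thesis using that by blast
qed

lemma finite_coeffA:
  fixes M :: "int monom" and n1 n2 :: int
  shows "finite {p::nat. (of_int (n1 - n2 + 2 * int p + 1) :: complex) *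
           ((phi (n1 + int p + 1) \<otimes>\<^bsub>phi_ring\<^esub> phi (n2 - int p)) M +
            (phi (n1 + int p) \<otimes>\<^bsub>phi_ring\<^esub> phi (n2 - int p - 1)) M) \<noteq> 0}" (is "finite ?S")
    and "finite {p::nat. (of_int (n1 - n2 + 2 * int p) :: complex) *
           (phi (n1 + int p) \<otimes>\<^bsub>phi_ring\<^esub> phi (n2 - int p)) M \<noteq> 0}" (is "finite ?T")
proof -
  let ?U = "\<Union>v\<in>Poly_Mapping.keys M. {..nat (v - n1)}"
  have *: "p \<in> ?U" if "(phi (n1 + int p + e) \<otimes>\<^bsub>phi_ring\<^esub> phi b) M \<noteq> 0" "e \<ge> 0" for p b e
  proof -
    have "n1 + int p + e \<in> Poly_Mapping.keys M"
      using phi_mult_phi_nonzero[OF that(1)] by (simp add: keys_add_monom)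
    thus ?thesis using that(2) by (intro UN_I) auto
  qed
  have "?S \<subseteq> ?U"
  proof
    fix p assume "p \<in> ?S"
    then consider "(phi (n1 + int p + 1) \<otimes>\<^bsub>phi_ring\<^esub> phi (n2 - int p)) M \<noteq> 0"
      | "(phi (n1 + int p + 0) \<otimes>\<^bsub>phi_ring\<^esub> phi (n2 - int p - 1)) M \<noteq> 0"
      by (cases "(phi (n1 + int p + 1) \<otimes>\<^bsub>phi_ring\<^esub> phi (n2 - int p)) M = 0") simp_all
    thus "p \<in> ?U"
      by cases (erule *, simp)+
  qed
  thus "finite ?S" by (rule finite_subset) auto
  have "?T \<subseteq> ?U"
  proof
    fix p assume "p \<in> ?T"
    hence "(phi (n1 + int p + 0) \<otimes>\<^bsub>phi_ring\<^esub> phi (n2 - int p)) M \<noteq> 0"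
      by simp
    thus "p \<in> ?U"
      by (rule *) simp
  qed
  thus "finite ?T" by (rule finite_subset) auto
qed

lemma coeffA_nonzeroE:
  assumes "coeffA n1 n2 M \<noteq> 0"
  obtains a b where "M = mono_var a + mono_var b" "n1 \<le> a" "b \<le> n2"
proof -
  let ?P = "\<exists>a b. (phi a \<otimes>\<^bsub>phi_ring\<^esub> phi b) M \<noteq> 0 \<and> n1 \<le> a \<and> b \<le> n2"
  define s1 where "s1 = sum' (\<lambda>p::nat. of_int (n1 - n2 + 2 * int p + 1) *
         ((phi (n1 + int p + 1) \<otimes>\<^bsub>phi_ring\<^esub> phi (n2 - int p)) M +
          (phi (n1 + int p) \<otimes>\<^bsub>phi_ring\<^esub> phi (n2 - int p - 1)) M)) UNIV"
  define s2 where "s2 = sum' (\<lambda>p::nat. of_int (n1 - n2 + 2 * int p) *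
         (phi (n1 + int p) \<otimes>\<^bsub>phi_ring\<^esub> phi (n2 - int p)) M) {1..}"
  have "coeffA n1 n2 M = s1 - of_int (n1 - n2) * (phi n1 \<otimes>\<^bsub>phi_ring\<^esub> phi n2) M - 2 * s2"
    by (simp add: coeffA_def s1_def s2_def)
  with assms consider "s1 \<noteq> 0" | "s2 \<noteq> 0" | "(phi n1 \<otimes>\<^bsub>phi_ring\<^esub> phi n2) M \<noteq> 0"
    by force
  hence ?P
  proof cases
    case 1
    then obtain p :: nat where
      "(phi (n1 + int p + 1) \<otimes>\<^bsub>phi_ring\<^esub> phi (n2 - int p)) M \<noteq> 0 \<or>
       (phi (n1 + int p) \<otimes>\<^bsub>phi_ring\<^esub> phi (n2 - int p - 1)) M \<noteq> 0"
      unfolding s1_def by (elim sum'_nonzeroE) force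
    thus ?thesis
    proof
      assume "(phi (n1 + int p + 1) \<otimes>\<^bsub>phi_ring\<^esub> phi (n2 - int p)) M \<noteq> 0"
      thus ?thesis by (intro exI[of _ "n1 + int p + 1"] exI[of _ "n2 - int p"]) simp
    next
      assume "(phi (n1 + int p) \<otimes>\<^bsub>phi_ring\<^esub> phi (n2 - int p - 1)) M \<noteq> 0"
      thus ?thesis by (intro exI[of _ "n1 + int p"] exI[of _ "n2 - int p - 1"]) simp
    qed
  next
    case 2
    then obtain p :: nat where
      "(phi (n1 + int p) \<otimes>\<^bsub>phi_ring\<^esub> phi (n2 - int p)) M \<noteq> 0"
      unfolding s2_def by (elim sum'_nonzeroE) force
    thus ?thesis by (intro exI[of _ "n1 + int p"] exI[of _ "n2 - int p"]) simp
  qed auto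
  thus ?thesis using that phi_mult_phi_nonzero by blast
qed

lemma coeffB_nonzeroE:
  assumes "coeffB z z' w w' n M \<noteq> 0"
  obtains a where "M = mono_var a" "a - 1 \<le> n" "n \<le> a + 1"
  using assms that[of "n + 1"] that[of "n - 1"] that[of n]
  by (auto simp: coeffB_def phi_def split: if_splits)

lemma finite_opD:
  fixes M :: "int monom" and f :: phi_series
  shows "finite {n. (coeffA n n \<otimes>\<^bsub>phi_ring\<^esub> phi_deriv n (phi_deriv n f)) M \<noteq> 0}" (is "finite ?S")
    and "finite {(n1, n2). n1 > n2 \<and>
      (coeffA n1 n2 \<otimes>\<^bsub>phi_ring\<^esub> phi_deriv n1 (phi_deriv n2 f)) M \<noteq> 0}" (is "finite ?T")
    and "finite {n. (coeffB z z' w w' n \<otimes>\<^bsub>phi_ring\<^esub> phi_deriv n f) M \<noteq> 0}" (is "finite ?U")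
proof -
  let ?K = "Poly_Mapping.keys M"
  let ?I = "\<Union>b\<in>?K. \<Union>a\<in>?K. {b..a}"
  have *: "n1 \<in> ?I \<and> n2 \<in> ?I"
    if g: "(coeffA n1 n2 \<otimes>\<^bsub>phi_ring\<^esub> g) M \<noteq> 0" and "n1 \<ge> n2" for n1 n2 g
  proof -
    obtain P Q where PQ: "P + Q = M" "coeffA n1 n2 P \<noteq> 0"
      by (rule phi_mult_nonzeroE[OF g])
    then obtain a b where "P = mono_var a + mono_var b" "n1 \<le> a" "b \<le> n2"
      by (elim coeffA_nonzeroE)
    moreover from this have "a \<in> ?K" "b \<in> ?K"
      using PQ(1) by (auto simp: keys_add_monom)
    ultimately show ?thesis
      using \<open>n1 \<ge> n2\<close> by (intro conjI UN_I[of b] UN_I[of a]) auto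
  qed
  have "?S \<subseteq> ?I" using * by blast
  thus "finite ?S" by (rule finite_subset) auto
  have "?T \<subseteq> ?I \<times> ?I" using * by fastforce
  thus "finite ?T" by (rule finite_subset) auto
  have "?U \<subseteq> (\<Union>a\<in>?K. {a - 1..a + 1})"
  proof
    fix n assume "n \<in> ?U"
    then obtain P Q where PQ: "P + Q = M" "coeffB z z' w w' n P \<noteq> 0"
      by (auto elim: phi_mult_nonzeroE)
    from PQ(2) obtain a where "P = mono_var a" "a - 1 \<le> n" "n \<le> a + 1"
      by (elim coeffB_nonzeroE)
    with PQ(1) show "n \<in> (\<Union>a\<in>?K. {a - 1..a + 1})"
      by (auto simp: keys_add_monom)
  qed
  thus "finite ?U" by (rule finite_subset) auto
qed

lemma opD_closed:
  assumes "f \<in> carrier phi_ring"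
  shows "opD z z' w w' f \<in> carrier phi_ring"
proof -
  obtain N where N: "\<And>M. mono_deg M > N \<Longrightarrow> f M = 0"
    using assms by (auto simp: phi_ring_simps)
  have A: "(coeffA n1 n2 \<otimes>\<^bsub>phi_ring\<^esub> phi_deriv n1 (phi_deriv n2 f)) M = 0"
    if "mono_deg M > N" for n1 n2 M
  proof (rule ccontr)
    assume "\<not> ?thesis"
    then obtain P Q where PQ: "P + Q = M" "coeffA n1 n2 P \<noteq> 0" "phi_deriv n1 (phi_deriv n2 f) Q \<noteq> 0"
      by (elim phi_mult_nonzeroE)
    from PQ(2) have "mono_deg P = 2"
      by (elim coeffA_nonzeroE) (simp add: mono_deg_add)
    moreover from PQ(3) have "f (Q + mono_var n1 + mono_var n2) \<noteq> 0"
      by (simp add: phi_deriv_def)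
    hence "mono_deg Q + 2 \<le> N"
      using N[of "Q + mono_var n1 + mono_var n2"] by (force simp: mono_deg_add)
    ultimately show False
      using that PQ(1) by (auto simp: mono_deg_add)
  qed
  have B: "(coeffB z z' w w' n \<otimes>\<^bsub>phi_ring\<^esub> phi_deriv n f) M = 0"
    if "mono_deg M > N" for n M
  proof (rule ccontr)
    assume "\<not> ?thesis"
    then obtain P Q where PQ: "P + Q = M" "coeffB z z' w w' n P \<noteq> 0" "phi_deriv n f Q \<noteq> 0"
      by (elim phi_mult_nonzeroE)
    from PQ(2) have "mono_deg P = 1"
      by (elim coeffB_nonzeroE) simp
    moreover from PQ(3) have "f (Q + mono_var n) \<noteq> 0"
      by (simp add: phi_deriv_def)
    hence "mono_deg Q + 1 \<le> N"
      using N[of "Q + mono_var n"] by (force simp: mono_deg_add)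
    ultimately show False
      using that PQ(1) by (auto simp: mono_deg_add)
  qed
  have "\<forall>M. mono_deg M > N \<longrightarrow> opD z z' w w' f M = 0"
    by (simp add: opD_def A B sum.G_def case_prod_unfold)
  thus ?thesis unfolding phi_ring_simps(1) by blast
qed


section \<open>The ideal and the quotient\<close>

text \<open>Both are stated for an index range from \<open>lo\<close> to \<open>hi\<close>, that is, for $J(\mathit{hi}, \mathit{lo})$.
  The argument of \<^const>\<open>Abs_poly_mapping\<close> has finite support for every series of bounded degree
  (lemma \<open>finite_truncation\<close>).\<close>

definition truncation :: "int \<Rightarrow> int \<Rightarrow> phi_series \<Rightarrow> int mpoly" where
  "truncation hi lo f =
     Abs_poly_mapping (\<lambda>M. if Poly_Mapping.keys M \<subseteq> {lo..hi} then f M else 0)"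

lemma finite_truncation:
  assumes "f \<in> carrier phi_ring"
  shows "finite {M. (if Poly_Mapping.keys M \<subseteq> {lo..hi} then f M else 0) \<noteq> 0}"
proof -
  obtain N where N: "\<And>M. mono_deg M > N \<Longrightarrow> f M = 0"
    using assms by (auto simp: phi_ring_simps)
  have le: "Poly_Mapping.lookup M v \<le> mono_deg M" for M and v :: int
    by (cases "v \<in> Poly_Mapping.keys M")
       (auto simp: mono_deg_def in_keys_iff intro: member_le_sum)
  have "{M. (if Poly_Mapping.keys M \<subseteq> {lo..hi} then f M else 0) \<noteq> 0} \<subseteq>
      {M. Poly_Mapping.keys M \<subseteq> {lo..hi} \<and> (\<forall>v. Poly_Mapping.lookup M v \<le> N)}"
    using N le by (auto split: if_splits) (meson le_trans not_le)
  thus ?thesis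
    by (rule finite_subset) (auto intro: finite_monom_bounded)
qed

definition ideal_I :: "int \<Rightarrow> int \<Rightarrow> phi_series set" where
  "ideal_I hi lo = a_kernel phi_ring (mpoly_ring {lo..hi}) (truncation hi lo)"

definition ideal_J :: "int \<Rightarrow> int \<Rightarrow> phi_series set" where
  "ideal_J hi lo = Idl\<^bsub>phi_ring\<^esub>
     (insert ((\<Oplus>\<^bsub>phi_ring\<^esub>n\<in>{lo..hi}. phi n) \<ominus>\<^bsub>phi_ring\<^esub> \<one>\<^bsub>phi_ring\<^esub>) (ideal_I hi lo))"

definition quot_op :: "('a, 'b) ring_scheme \<Rightarrow> 'a set \<Rightarrow> ('a \<Rightarrow> 'a) \<Rightarrow> 'a set \<Rightarrow> 'a set" where
  "quot_op R J T X = the_elem ((\<lambda>f. J +>\<^bsub>R\<^esub> T f) ` X)"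


section \<open>Identification with symmetric polynomials\<close>

text \<open>Laurent polynomials in \<open>u\<close> over the polynomial ring: the monomial \<open>c u\<^sup>n\<close> is
  \<open>Poly_Mapping.single n c\<close>.\<close>

definition gen_product :: "nat \<Rightarrow> nat \<Rightarrow> int \<Rightarrow>\<^sub>0 nat mpoly" where
  "gen_product k l =
     (\<Prod>i\<in>{1..k}. Poly_Mapping.single 0 (pvar i) + Poly_Mapping.single 1 (1 - pvar i)) *
     (\<Prod>i\<in>{k+1..k+l}. Poly_Mapping.single 0 (1 - pvar i) + Poly_Mapping.single (-1) (pvar i))"

definition phi_in_t :: "nat \<Rightarrow> nat \<Rightarrow> int \<Rightarrow> nat mpoly" where
  "phi_in_t k l n = Poly_Mapping.lookup (gen_product k l) n"

text \<open>On a coset the value is the common value of \<open>psubst \<circ> truncation\<close> on its representatives.\<close>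

definition identification :: "nat \<Rightarrow> nat \<Rightarrow> phi_series set \<Rightarrow> nat mpoly" where
  "identification k l X =
     the_elem ((\<lambda>f. psubst (phi_in_t k l) (truncation (int k) (- int l) f)) ` X)"


section \<open>The Jacobi operator\<close>

text \<open>Because of the denominators $t_i - t_j$ the operator takes values in the field of rational
  functions; that it maps symmetric polynomials to symmetric polynomials is a theorem.\<close>

definition jacobi_op :: "nat \<Rightarrow> complex \<Rightarrow> complex \<Rightarrow> nat mpoly \<Rightarrow> nat mpoly fract" where
  "jacobi_op m a b f = (\<Sum>i\<in>{1..m}.
     to_fract (pvar i * (1 - pvar i)) * to_fract (pderivative i (pderivative i f))
     + (to_fract (pconst (b + 1) - pconst (a + b + 2) * pvar i)
        + (\<Sum>j\<in>{1..m} - {i}. to_fract (2 * pvar i * (1 - pvar i)) / to_fract (pvar i - pvar j)))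
       * to_fract (pderivative i f))"

end

theory Submission
  imports Defs
begin

text \<open>
  Write \<open>e\<^sub>n\<close> for the coefficient of \<open>u\<^sup>n\<close> in \<open>E(u) = \<Prod>\<^sub>i (t\<^sub>i + (1 - t\<^sub>i) u)\<close> over \<open>m = k + l\<close> variables, so that
  \<open>\<phi>\<^sub>n\<close> is identified with \<open>e\<^sub>n\<^sub>+\<^sub>l\<close>. Both operators are of second order without constant term, so by the
  chain rule it suffices to compare them on the \<open>\<phi>\<^sub>n\<close> and to compare their symbols. Since
  \<open>\<partial>E/\<partial>t\<^sub>i = (1 - u) E\<^sub>i(u)\<close>, where \<open>E\<^sub>i\<close> omits the \<open>i\<close>-th factor, and \<open>u E'(u) = \<Sum>\<^sub>i (1 - t\<^sub>i) u E\<^sub>i(u)\<close>, the symbol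
  \<open>\<Gamma>(f, g) = \<Sum>\<^sub>i t\<^sub>i (1 - t\<^sub>i) \<partial>\<^sub>if \<partial>\<^sub>ig\<close> satisfies
  \<open>(u - v) \<Gamma>(E(u), E(v)) = (1 - u) (1 - v) (u E'(u) E(v) - v E(u) E'(v))\<close>; telescoping the resulting
  recurrence for \<open>\<Gamma>(e\<^sub>a, e\<^sub>b)\<close> gives the coefficients \<open>A\<close>. The choice \<open>z = k\<close>, \<open>w = l\<close> makes \<open>B\<^sub>n\<close> vanish modulo
  \<open>I(k,-l)\<close> for \<open>n\<close> outside the window. As \<open>J(k,-l)\<close> is the kernel of the map to symmetric polynomials,
  its invariance follows from the intertwining relation.

  That the map is onto with this kernel is an induction on \<open>m\<close>: at \<open>t\<^sub>m = 0\<close> the \<open>e\<^sub>n\<close> specialize to the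
  \<open>e\<^sub>n\<^sub>-\<^sub>1\<close> in \<open>m - 1\<close> variables, and a symmetric polynomial vanishing there is divisible by
  \<open>e\<^sub>0 = t\<^sub>1 \<cdots> t\<^sub>m\<close>. The degree controlled in this induction is the one in each single variable.
\<close>

section \<open>Polynomials and substitutions\<close>

abbreviation "lookup \<equiv> Poly_Mapping.lookup"
abbreviation "keys \<equiv> Poly_Mapping.keys"
abbreviation "single \<equiv> Poly_Mapping.single"

lemma poly_mapping_sum_single: "p = (\<Sum>M\<in>keys p. single M (lookup p M))"
proof (rule poly_mapping_eqI)
  fix N
  have "lookup (\<Sum>M\<in>keys p. single M (lookup p M)) N =
      (\<Sum>M\<in>keys p. if M = N then lookup p M else 0)"
    by (simp add: lookup_sum lookup_single when_def)
  also have "\<dots> = lookup p N"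
    by (simp add: in_keys_iff)
  finally show "lookup p N = lookup (\<Sum>M\<in>keys p. single M (lookup p M)) N" by simp
qed

section \<open>Occurring variables and induction on polynomials\<close>

definition mpoly_vars :: "'v mpoly \<Rightarrow> 'v set" where
  "mpoly_vars p = (\<Union>M\<in>keys p. keys M)"

lemma mem_mpoly_ring: "p \<in> carrier (mpoly_ring V) \<longleftrightarrow> mpoly_vars p \<subseteq> V"
  by (auto simp: mpoly_ring_def mpoly_vars_def)

lemma single_add_monom: "single (M + N) (1::complex) = single M 1 * single N 1"
  by (simp add: mult_single)

lemma single_conv_pconst: "single M c = pconst c * single M 1"
  by (simp add: pconst_def mult_single)

text \<open>A monomial is a product of powers of its variables: the induction runs over the exponent
  of one variable, then over the support.\<close>

lemma single_monom_induct:
  fixes M :: "'v monom"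
  assumes "keys M \<subseteq> V" and one: "P 1" and "\<And>v. v \<in> V \<Longrightarrow> P (pvar v)"
    and mult: "\<And>p q. P p \<Longrightarrow> P q \<Longrightarrow> P (p * q)"
  shows "P (single M 1)"
proof -
  have pow: "P (single (single v n) 1)" if "v \<in> V" for v n
  proof (induction n)
    case 0 then show ?case using one by (simp flip: single_one)
  next
    case (Suc n)
    have "single (single v (Suc n)) (1::complex) = single (single v n) 1 * pvar v"
      by (simp add: pvar_def mult_single mono_var_def flip: single_add)
    then show ?case using mult[OF Suc assms(3)[OF that]] by simp
  qed
  have "P (single (\<Sum>v\<in>W. single v (lookup M v)) 1)" if "finite W" "W \<subseteq> V" for W
    using that
  proof (induction W)
    case empty then show ?case using one by simp
  next
    case (insert x F)
    then show ?case using mult[OF pow[of x] insert.IH] by (simp add: single_add_monom)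
  qed
  from this[of "keys M"] show ?thesis
    using assms(1) poly_mapping_sum_single[of M] by simp
qed

text \<open>Identities between substitutions and derivations are reduced by this rule to constants
  and variables. The bound \<open>V\<close> on the variables remains available in the variable
  case.\<close>

lemma mpoly_induct [consumes 1, case_names const var add mult]:
  fixes p :: "'v mpoly"
  assumes "mpoly_vars p \<subseteq> V" and const: "\<And>c. P (pconst c)" and "\<And>v. v \<in> V \<Longrightarrow> P (pvar v)"
    and add: "\<And>p q. P p \<Longrightarrow> P q \<Longrightarrow> P (p + q)"
    and mult: "\<And>p q. P p \<Longrightarrow> P q \<Longrightarrow> P (p * q)"
  shows "P p"
proof -
  have one: "P 1" using const[of 1] by (simp add: pconst_def)
  have 0: "P 0" using const[of 0] by (simp add: pconst_def)
  have *: "P (single M (lookup p M))" if "M \<in> keys p" for M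
  proof -
    have "keys M \<subseteq> V" using assms(1) that by (auto simp: mpoly_vars_def)
    then have "P (single M 1)" by (rule single_monom_induct) (use one assms(3) mult in auto)
    from mult[OF const this] show ?thesis by (simp flip: single_conv_pconst)
  qed
  have "P (\<Sum>M\<in>W. single M (lookup p M))" if "finite W" "W \<subseteq> keys p" for W
    using that by (induction W) (auto intro: 0 add *)
  from this[of "keys p"] show ?thesis
    using poly_mapping_sum_single[of p] by simp
qed

lemma pconst_0 [simp]: "pconst 0 = 0" and pconst_1 [simp]: "pconst 1 = 1"
  by (simp_all add: pconst_def)

lemma pconst_add: "pconst (a + b) = pconst a + pconst b"
  by (simp add: pconst_def single_add)

lemma pconst_mult: "pconst (a * b) = pconst a * pconst b"
  by (simp add: pconst_def mult_single)

lemma pconst_diff: "pconst (a - b) = pconst a - pconst b"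
  by (simp add: pconst_def single_diff)

lemma pconst_of_nat: "pconst (of_nat n) = of_nat n"
  by (simp add: pconst_def)

lemma pconst_of_int: "pconst (of_int n) = of_int n"
  by (simp add: pconst_def)

text \<open>Rewrites the convolution as the finite sum over splittings of \<open>M\<close> that
  defines the product of \<open>phi_ring\<close>, so the two products can be compared coefficient by
  coefficient.\<close>

lemma lookup_mult_splits:
  fixes p q :: "'v mpoly"
  shows "lookup (p * q) M = (\<Sum>(P, Q) | P + Q = M. lookup p P * lookup q Q)"
proof -
  have "lookup (p * q) M = (\<Sum>(a, b). lookup p a * lookup q b when M = a + b)"
    by (simp add: times_poly_mapping.rep_eq prod_fun_unfold_prod)
  also have "\<dots> = (\<Sum>(a, b) | a + b = M. lookup p a * lookup q b when M = a + b)"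
    by (rule Sum_any.expand_superset) (auto simp: finite_splits)
  also have "\<dots> = (\<Sum>(P, Q) | P + Q = M. lookup p P * lookup q Q)"
    by (intro sum.cong) (auto simp: when_def)
  finally show ?thesis .
qed

lemma lookup_single_mult:
  fixes p :: "'v mpoly"
  shows "lookup (single P c * p) (P + M) = c * lookup p M"
proof -
  have "lookup (single P c * p) (P + M) = (\<Sum>(A, B)\<in>{(P, M)}. lookup (single P c) A * lookup p B)"
    unfolding lookup_mult_splits
    by (rule sum.mono_neutral_right) (auto simp: finite_splits lookup_single when_def split: if_splits)
  then show ?thesis by simp
qed

lemma lookup_pconst_mult: "lookup (pconst c * p) M = c * lookup p M"
  using lookup_single_mult[of 0 c p M] by (simp add: pconst_def)

section \<open>Evaluation of monomials and substitution homomorphisms\<close>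

definition mono_eval :: "('v \<Rightarrow> 'a::comm_monoid_mult) \<Rightarrow> 'v monom \<Rightarrow> 'a" where
  "mono_eval g M = (\<Prod>v\<in>keys M. g v ^ lookup M v)"

lemma mono_eval_superset:
  assumes "finite V" "keys M \<subseteq> V"
  shows "mono_eval g M = (\<Prod>v\<in>V. g v ^ lookup M v)"
  unfolding mono_eval_def using assms
  by (intro prod.mono_neutral_left) (auto simp: in_keys_iff)

lemma mono_eval_0 [simp]: "mono_eval g 0 = 1"
  by (simp add: mono_eval_def)

lemma mono_eval_add: "mono_eval g (M + N) = mono_eval g M * mono_eval g N"
proof -
  have *: "mono_eval g R = (\<Prod>v\<in>keys M \<union> keys N. g v ^ lookup R v)"
    if "keys R \<subseteq> keys M \<union> keys N" for R
    using that by (intro mono_eval_superset) auto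
  show ?thesis
    by (subst (1 2 3) *) (auto simp: keys_add_monom lookup_add power_add prod.distrib)
qed

lemma mono_eval_var [simp]: "mono_eval g (mono_var v) = g v"
  by (simp add: mono_eval_def) (simp add: mono_var_def)

text \<open>With any finite index set containing the support, several polynomials can be expanded
  over one common set.\<close>

lemma psubst_superset:
  assumes "finite S" "keys p \<subseteq> S"
  shows "psubst g p = (\<Sum>M\<in>S. pconst (lookup p M) * mono_eval g M)"
  unfolding psubst_def mono_eval_def using assms
  by (intro sum.mono_neutral_left) (auto simp: in_keys_iff)

lemma psubst_single: "psubst g (single M c) = pconst c * mono_eval g M"
  by (subst psubst_superset[of "{M}"]) auto

lemma psubst_0 [simp]: "psubst g 0 = 0"
  by (simp add: psubst_def)

lemma psubst_add: "psubst g (p + q) = psubst g p + psubst g q"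
proof -
  have *: "psubst g r = (\<Sum>M\<in>keys p \<union> keys q. pconst (lookup r M) * mono_eval g M)"
    if "keys r \<subseteq> keys p \<union> keys q" for r
    using that by (intro psubst_superset) auto
  have "keys (p + q) \<subseteq> keys p \<union> keys q" by (rule keys_add)
  then show ?thesis
    by (subst (1 2 3) *) (auto simp: lookup_add pconst_add ring_distribs sum.distrib)
qed

lemma psubst_sum: "psubst g (sum f A) = (\<Sum>x\<in>A. psubst g (f x))"
  by (induction A rule: infinite_finite_induct) (auto simp: psubst_add)

lemma psubst_mult: "psubst g (p * q) = psubst g p * psubst g q"
proof -
  have "psubst g (p * q) = psubst g (\<Sum>M\<in>keys p. \<Sum>N\<in>keys q.
      single M (lookup p M) * single N (lookup q N))"
    by (simp flip: sum_product poly_mapping_sum_single)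
  also have "\<dots> = (\<Sum>M\<in>keys p. \<Sum>N\<in>keys q.
      (pconst (lookup p M) * mono_eval g M) * (pconst (lookup q N) * mono_eval g N))"
    by (simp add: psubst_sum mult_single psubst_single mono_eval_add pconst_mult mult_ac)
  also have "\<dots> = psubst g p * psubst g q"
    by (subst (1 2) psubst_superset[OF finite_keys order_refl]) (simp add: sum_product)
  finally show ?thesis .
qed

lemma psubst_pconst [simp]: "psubst g (pconst c) = pconst c"
  using psubst_single[of g 0 c] by (simp flip: pconst_def)

lemma psubst_1 [simp]: "psubst g 1 = 1"
  using psubst_pconst[of g 1] by simp

lemma psubst_pvar [simp]: "psubst g (pvar v) = g v"
  by (simp add: pvar_def psubst_single)

lemma psubst_uminus: "psubst g (- p) = - psubst g p"
  using psubst_add[of g p "- p"] by (simp add: eq_neg_iff_add_eq_0 add.commute)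

lemma psubst_diff: "psubst g (p - q) = psubst g p - psubst g q"
  using psubst_add[of g p "- q"] by (simp add: psubst_uminus)

lemma psubst_psubst: "psubst g (psubst h p) = psubst (\<lambda>v. psubst g (h v)) p"
  using order_refl[of "mpoly_vars p"]
  by (induction p rule: mpoly_induct) (auto simp: psubst_add psubst_mult)

lemma psubst_pvar_id [simp]: "psubst pvar p = p"
  using order_refl[of "mpoly_vars p"]
  by (induction p rule: mpoly_induct) (auto simp: psubst_add psubst_mult)

lemma psubst_cong:
  assumes "\<And>v. v \<in> mpoly_vars p \<Longrightarrow> g v = h v"
  shows "psubst g p = psubst h p"
  unfolding psubst_def
proof (intro sum.cong refl arg_cong2[where f="(*)"] prod.cong)
  fix M v assume "M \<in> keys p" "v \<in> keys M"
  then have "v \<in> mpoly_vars p" by (auto simp: mpoly_vars_def)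
  then show "g v ^ lookup M v = h v ^ lookup M v" by (simp add: assms)
qed

section \<open>Bounds on the occurring variables\<close>

lemma mpoly_vars_pconst [simp]: "mpoly_vars (pconst c) = {}"
  by (auto simp: mpoly_vars_def pconst_def)

lemma mpoly_vars_0 [simp]: "mpoly_vars 0 = {}" and mpoly_vars_1 [simp]: "mpoly_vars 1 = {}"
  by (auto simp: mpoly_vars_def)

lemma mpoly_vars_pvar [simp]: "mpoly_vars (pvar v) = {v}"
  by (auto simp: mpoly_vars_def pvar_def)

lemma mpoly_vars_add: "mpoly_vars (p + q) \<subseteq> mpoly_vars p \<union> mpoly_vars q"
  unfolding mpoly_vars_def using keys_add[of p q] by blast

lemma mpoly_vars_mult: "mpoly_vars (p * q) \<subseteq> mpoly_vars p \<union> mpoly_vars q"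
proof
  fix v assume "v \<in> mpoly_vars (p * q)"
  then obtain M where "M \<in> keys (p * q)" "v \<in> keys M" by (auto simp: mpoly_vars_def)
  then obtain P Q where "P \<in> keys p" "Q \<in> keys q" "v \<in> keys P \<union> keys Q"
    using keys_mult[of p q] by (auto simp: keys_add_monom)
  then show "v \<in> mpoly_vars p \<union> mpoly_vars q" by (auto simp: mpoly_vars_def)
qed

lemma mpoly_vars_uminus [simp]: "mpoly_vars (- p) = mpoly_vars p"
  by (simp add: mpoly_vars_def)

lemma mpoly_vars_diff: "mpoly_vars (p - q) \<subseteq> mpoly_vars p \<union> mpoly_vars q"
  using mpoly_vars_add[of p "- q"] by simp

lemma mpoly_vars_sum: "mpoly_vars (sum f A) \<subseteq> (\<Union>x\<in>A. mpoly_vars (f x))"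
proof (induction A rule: infinite_finite_induct)
  case (insert x F)
  then show ?case using mpoly_vars_add[of "f x" "sum f F"] by auto
qed auto

lemma mpoly_vars_psubst:
  assumes "\<And>v. v \<in> mpoly_vars p \<Longrightarrow> mpoly_vars (g v) \<subseteq> V"
  shows "mpoly_vars (psubst g p) \<subseteq> V"
  using order_refl[of "mpoly_vars p"]
proof (induction p rule: mpoly_induct)
  case (add p q)
  then show ?case using mpoly_vars_add[of "psubst g p" "psubst g q"] by (auto simp: psubst_add)
next
  case (mult p q)
  then show ?case using mpoly_vars_mult[of "psubst g p" "psubst g q"] by (auto simp: psubst_mult)
qed (use assms in auto)

lemma mpoly_no_vars:
  assumes "mpoly_vars p = {}"
  shows "p = pconst (lookup p 0)"
proof (rule poly_mapping_eqI)
  fix M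
  show "lookup p M = lookup (pconst (lookup p 0)) M"
    using assms by (cases "M = 0") (auto simp: pconst_def lookup_single when_def mpoly_vars_def in_keys_iff)
qed

section \<open>Divisibility by a variable and specialization at zero\<close>

lemma pvar_dvd_iff: "pvar v dvd p \<longleftrightarrow> (\<forall>M\<in>keys p. v \<in> keys M)"
proof
  assume "pvar v dvd p"
  then obtain q where q: "p = pvar v * q" by blast
  show "\<forall>M\<in>keys p. v \<in> keys M"
    using keys_mult[of "pvar v" q] by (auto simp: q pvar_def keys_add_monom)
next
  assume *: "\<forall>M\<in>keys p. v \<in> keys M"
  \<comment> \<open>Subtraction of exponents is truncated; it is inverted by addition only because
    \<open>v\<close> occurs in \<open>M\<close>. The quotient below lowers the exponent of
    \<open>v\<close> in every monomial.\<close>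
  have eq: "mono_var v + (M - mono_var v) = M" if "v \<in> keys M" for M
    using that by (intro poly_mapping_eqI)
      (auto simp: lookup_add lookup_minus mono_var_def lookup_single when_def in_keys_iff)
  have "p = (\<Sum>M\<in>keys p. single M (lookup p M))"
    by (rule poly_mapping_sum_single)
  also have "\<dots> = pvar v * (\<Sum>M\<in>keys p. single (M - mono_var v) (lookup p M))"
    by (simp add: sum_distrib_left pvar_def mult_single eq * cong: sum.cong)
  finally show "pvar v dvd p" by (rule dvdI)
qed

text \<open>Specialization to the hyperplane where \<open>v\<close> vanishes. It is applied both to
  the \<open>t\<^sub>i\<close> and to the \<open>\<phi>\<^sub>n\<close>, and drives the inductions
  on the number of variables.\<close>

definition kill :: "'v \<Rightarrow> 'v mpoly \<Rightarrow> 'v mpoly" where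
  "kill v = psubst (\<lambda>i. if i = v then 0 else pvar i)"

lemma mono_eval_pvar: "mono_eval pvar M = single M 1"
  using psubst_single[of pvar M 1] by simp

lemma lookup_kill: "lookup (kill v p) N = (if v \<in> keys N then 0 else lookup p N)"
proof -
  let ?g = "\<lambda>i. if i = v then 0 else pvar i"
  have me: "mono_eval ?g M = (if v \<in> keys M then 0 else single M 1)" for M
  proof (cases "v \<in> keys M")
    case True
    then have "?g v ^ lookup M v = 0" by (simp add: in_keys_iff zero_power)
    then show ?thesis unfolding mono_eval_def
      using True by (simp only: if_True) (rule prod_zero, auto)
  next
    case False
    then have "mono_eval ?g M = mono_eval pvar M"
      unfolding mono_eval_def by (intro prod.cong) auto
    then show ?thesis using False by (simp add: mono_eval_pvar)
  qed
  have "kill v p = (\<Sum>M\<in>keys p. if v \<in> keys M then 0 else single M (lookup p M))"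
    unfolding kill_def psubst_superset[OF finite_keys order_refl] me
    by (intro sum.cong refl) (simp flip: single_conv_pconst)
  then have "lookup (kill v p) N = (\<Sum>M\<in>keys p. if M = N then (if v \<in> keys M then 0 else lookup p M) else 0)"
    by (simp only: lookup_sum) (intro sum.cong refl, simp add: lookup_single when_def)
  also have "\<dots> = (if v \<in> keys N then 0 else lookup p N)"
    by (simp add: in_keys_iff)
  finally show ?thesis .
qed

text \<open>The specialization deletes exactly the monomials containing \<open>v\<close>, so it
  annihilates \<open>p\<close> precisely when no other monomials occur.\<close>

lemma kill_eq_0_iff: "kill v p = 0 \<longleftrightarrow> pvar v dvd p"
  unfolding pvar_dvd_iff poly_mapping_eq_iff fun_eq_iff lookup_kill
  by (metis in_keys_iff lookup_zero)

lemma lookup_eq_0_notin_vars: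
  assumes "v \<notin> mpoly_vars p" "v \<in> keys M"
  shows "lookup p M = 0"
  using assms by (metis UN_I in_keys_iff mpoly_vars_def)

lemma mpoly_vars_kill: "mpoly_vars (kill v p) \<subseteq> mpoly_vars p - {v}"
  by (auto simp: mpoly_vars_def in_keys_iff lookup_kill split: if_splits)

lemma kill_idem: "v \<notin> mpoly_vars p \<Longrightarrow> kill v p = p"
  by (intro poly_mapping_eqI) (simp add: lookup_kill lookup_eq_0_notin_vars)

section \<open>Partial derivatives\<close>

lemma lookup_pderivative:
  "lookup (pderivative v p) M = of_nat (lookup M v + 1) * lookup p (M + mono_var v)"
proof -
  \<comment> \<open>If \<open>v\<close> does not occur in \<open>N\<close>, truncated subtraction
    may identify \<open>N - mono_var v\<close> with \<open>M\<close> wrongly, but then the exponent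
    factor is zero. Otherwise only \<open>N = M + mono_var v\<close> contributes.\<close>
  have *: "(of_nat (lookup N v) * lookup p N when N - mono_var v = M) =
      (if N = M + mono_var v then of_nat (lookup M v + 1) * lookup p (M + mono_var v) else 0)" for N
  proof (cases "lookup N v = 0")
    case True
    then show ?thesis by (auto simp: lookup_add mono_var_def)
  next
    case False
    then have "(N - mono_var v) + mono_var v = N"
      by (intro poly_mapping_eqI)
         (auto simp: lookup_add lookup_minus mono_var_def lookup_single when_def)
    then have "N - mono_var v = M \<longleftrightarrow> N = M + mono_var v" by auto
    then show ?thesis by (auto simp: when_def lookup_add mono_var_def)
  qed
  have "lookup (pderivative v p) M =
      (\<Sum>N\<in>keys p. if N = M + mono_var v then of_nat (lookup M v + 1) * lookup p (M + mono_var v) else 0)"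
    by (simp add: pderivative_def lookup_sum lookup_single *)
  then show ?thesis by (simp add: in_keys_iff)
qed

lemma pderivative_add: "pderivative v (p + q) = pderivative v p + pderivative v q"
  by (intro poly_mapping_eqI) (simp add: lookup_pderivative lookup_add ring_distribs)

lemma pderivative_0 [simp]: "pderivative v 0 = 0"
  by (simp add: pderivative_def)

lemma pderivative_uminus: "pderivative v (- p) = - pderivative v p"
  using pderivative_add[of v p "- p"] by (simp add: eq_neg_iff_add_eq_0 add.commute)

lemma pderivative_diff: "pderivative v (p - q) = pderivative v p - pderivative v q"
  using pderivative_add[of v p "- q"] by (simp add: pderivative_uminus)

lemma pderivative_sum: "pderivative v (sum f A) = (\<Sum>x\<in>A. pderivative v (f x))"
  by (induction A rule: infinite_finite_induct) (auto simp: pderivative_add)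

lemma pderivative_single:
  "pderivative v (single M c) = single (M - mono_var v) (of_nat (lookup M v) * c)"
  by (cases "c = 0") (simp_all add: pderivative_def)

text \<open>Both sides are bilinear, so products of two monomials suffice; these are treated by
  cases on whether \<open>v\<close> occurs in each factor.\<close>

lemma pderivative_mult: "pderivative v (p * q) = pderivative v p * q + p * pderivative v q"
proof -
  have M: "M + N - mono_var v = (M - mono_var v) + N" if "lookup M v \<noteq> 0" for M N
    using that by (intro poly_mapping_eqI)
      (auto simp: lookup_add lookup_minus mono_var_def lookup_single when_def)
  have s: "pderivative v (single M a * single N b) =
      pderivative v (single M a) * single N b + single M a * pderivative v (single N b)" for M N a b
    using M[of M N] M[of N M]
    by (cases "lookup M v = 0"; cases "lookup N v = 0")
       (simp_all add: mult_single pderivative_single lookup_add add.commute ring_distribs mult_ac single_add)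
  have "pderivative v (p * q) = pderivative v (\<Sum>M\<in>keys p. \<Sum>N\<in>keys q.
      single M (lookup p M) * single N (lookup q N))"
    by (simp flip: sum_product poly_mapping_sum_single)
  also have "\<dots> = (\<Sum>M\<in>keys p. pderivative v (single M (lookup p M))) * (\<Sum>N\<in>keys q. single N (lookup q N))
     + (\<Sum>M\<in>keys p. single M (lookup p M)) * (\<Sum>N\<in>keys q. pderivative v (single N (lookup q N)))"
    by (simp add: pderivative_sum s sum.distrib sum_product)
  also have "\<dots> = pderivative v p * q + p * pderivative v q"
    by (simp flip: poly_mapping_sum_single pderivative_sum)
  finally show ?thesis .
qed

lemma pderivative_pconst [simp]: "pderivative v (pconst c) = 0"
  by (simp add: pconst_def pderivative_single)

lemma pderivative_1 [simp]: "pderivative v 1 = 0"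
  using pderivative_pconst[of v 1] by simp

lemma pderivative_pvar: "pderivative v (pvar w) = (if v = w then 1 else 0)"
  by (auto simp: pvar_def pderivative_single mono_var_def lookup_single when_def single_one)

lemma pderivative_eq_0: "v \<notin> mpoly_vars p \<Longrightarrow> pderivative v p = 0"
  by (intro poly_mapping_eqI)
     (simp add: lookup_pderivative lookup_eq_0_notin_vars keys_add_monom)

lemma mpoly_vars_pderivative: "mpoly_vars (pderivative v p) \<subseteq> mpoly_vars p"
proof -
  have "keys M \<subseteq> mpoly_vars p" if "M \<in> keys (pderivative v p)" for M
  proof -
    have "M + mono_var v \<in> keys p" using that by (auto simp: in_keys_iff lookup_pderivative)
    then show ?thesis by (auto simp: mpoly_vars_def keys_add_monom intro!: bexI[of _ "M + mono_var v"])
  qed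
  then show ?thesis by (auto simp: mpoly_vars_def)
qed

text \<open>The chain rule: both sides are derivations along the homomorphism
  \<open>psubst g\<close>, so agreement on constants and variables is enough. A finite
  \<open>V\<close> containing all variables keeps the sum finite.\<close>

lemma pderivative_psubst:
  assumes "mpoly_vars p \<subseteq> V" "finite V"
  shows "pderivative i (psubst g p) = (\<Sum>n\<in>V. psubst g (pderivative n p) * pderivative i (g n))"
  using assms(1)
proof (induction p rule: mpoly_induct)
  case (var v)
  have "(\<Sum>n\<in>V. psubst g (pderivative n (pvar v)) * pderivative i (g n)) =
      (\<Sum>n\<in>V. if n = v then pderivative i (g v) else 0)"
    by (intro sum.cong) (auto simp: pderivative_pvar)
  then show ?case using var assms(2) by simp
next
  case (mult p q)
  then show ?case
    by (simp add: psubst_mult psubst_add pderivative_mult ring_distribs sum.distrib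
        sum_distrib_left sum_distrib_right mult_ac)
qed (auto simp: psubst_add pderivative_add ring_distribs sum.distrib)

section \<open>The generating polynomials\<close>

lemma lookup_single_mult_int:
  fixes G :: "int \<Rightarrow>\<^sub>0 'a::semiring_0"
  shows "lookup (single a c * G) n = c * lookup G (n - a)"
proof -
  have eq: "n = l + q \<longleftrightarrow> q = n - l" for l q by auto
  have "lookup (single a c * G) n = Sum_any (\<lambda>l. c * lookup G (n - l) when a = l)"
    by (simp add: lookup_mult eq lookup_single when_mult)
  then show ?thesis by simp
qed

text \<open>The coefficient \<open>e\<^sub>n\<close> of \<open>E(u)\<close>, taken over an arbitrary
  set of variables so that factors can be omitted. The integer index lets shifts run out of range,
  where the value is 0, without case distinctions.\<close>

definition esym :: "nat set \<Rightarrow> int \<Rightarrow> nat mpoly" where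
  "esym S n = lookup (\<Prod>i\<in>S. single 0 (pvar i) + single 1 (1 - pvar i)) n"

lemma esym_empty: "esym {} n = (if n = 0 then 1 else 0)"
  by (simp add: esym_def lookup_one when_def)

lemma esym_insert:
  assumes "finite S" "j \<notin> S"
  shows "esym (insert j S) n = pvar j * esym S n + (1 - pvar j) * esym S (n - 1)"
  using assms by (simp add: esym_def distrib_right lookup_add lookup_single_mult_int)

lemma esym_remove:
  assumes "finite S" "j \<in> S"
  shows "esym S n = pvar j * esym (S - {j}) n + (1 - pvar j) * esym (S - {j}) (n - 1)"
  using esym_insert[of "S - {j}" j n] assms by (simp add: insert_absorb)

text \<open>Since \<open>1 - t + t/u = (t + (1 - t) u)/u\<close>, each of the last \<open>l\<close>
  factors is a factor of the first kind divided by \<open>u\<close>. Together they shift the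
  exponent by \<open>l\<close>.\<close>

lemma phi_in_t_esym: "phi_in_t k l n = esym {1..k+l} (n + int l)"
proof -
  define F where "F = (\<lambda>i. single (0::int) (pvar i) + single 1 (1 - pvar (i::nat)))"
  have single_power: "single (-1::int) (1::nat mpoly) ^ j = single (- int j) 1" for j
    by (induction j) (simp_all add: mult_single)
  have "(\<Prod>i\<in>{k+1..k+l}. single 0 (1 - pvar i) + single (-1) (pvar i)) =
      (\<Prod>i\<in>{k+1..k+l}. single (-1::int) 1 * F i)"
    by (intro prod.cong) (auto simp: F_def distrib_left mult_single)
  also have "\<dots> = single (- int l) 1 * prod F {k+1..k+l}"
    by (simp add: prod.distrib single_power)
  finally have "gen_product k l = single (- int l) 1 * (prod F {1..k} * prod F {k+1..k+l})"
    by (simp add: gen_product_def F_def mult_ac)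
  also have "prod F {1..k} * prod F {k+1..k+l} = prod F {1..k+l}"
    by (subst prod.union_disjoint[symmetric]) (auto intro!: prod.cong)
  finally show ?thesis
    by (simp add: phi_in_t_def esym_def F_def lookup_single_mult_int)
qed

lemma esym_eq_0:
  assumes "finite S" "n < 0 \<or> n > int (card S)"
  shows "esym S n = 0"
  using assms by (induction S arbitrary: n) (auto simp: esym_empty esym_insert)

lemma mpoly_vars_esym: "finite S \<Longrightarrow> mpoly_vars (esym S n) \<subseteq> S"
proof (induction S arbitrary: n rule: finite_induct)
  case (insert j S)
  have "mpoly_vars (1 - pvar j) \<subseteq> {j}"
    using mpoly_vars_diff[of 1 "pvar j"] by simp
  then have "mpoly_vars (pvar j * esym S n + (1 - pvar j) * esym S (n - 1)) \<subseteq>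
      {j} \<union> mpoly_vars (esym S n) \<union> mpoly_vars (esym S (n - 1))"
    using mpoly_vars_add[of "pvar j * esym S n" "(1 - pvar j) * esym S (n - 1)"]
      mpoly_vars_mult[of "pvar j" "esym S n"] mpoly_vars_mult[of "1 - pvar j" "esym S (n - 1)"]
    unfolding mpoly_vars_pvar by blast
  then show ?case
    using insert.IH[of n] insert.IH[of "n - 1"] insert.hyps by (simp add: esym_insert) blast
qed (simp add: esym_empty)

lemma sum_shift_int:
  fixes f :: "int \<Rightarrow> 'a::comm_monoid_add"
  shows "(\<Sum>n=lo..hi. f (n - 1)) = (\<Sum>n=lo-1..hi-1. f n)"
  by (rule sum.reindex_bij_witness[where i = "\<lambda>n. n + 1" and j = "\<lambda>n. n - 1"]) auto

text \<open>This is \<open>E(1) = 1\<close>, as every factor is 1 at \<open>u = 1\<close>. The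
  limits are left free because the induction step also needs the range shifted by one.\<close>

lemma sum_esym:
  assumes "finite S" "lo \<le> 0" "int (card S) \<le> hi"
  shows "(\<Sum>n=lo..hi. esym S n) = 1"
  using assms
proof (induction S arbitrary: lo hi)
  case empty
  then show ?case by (simp add: esym_empty)
next
  case (insert j S)
  have "(\<Sum>n=lo..hi. esym (insert j S) n) =
      pvar j * (\<Sum>n=lo..hi. esym S n) + (1 - pvar j) * (\<Sum>n=lo-1..hi-1. esym S n)"
    using insert.hyps by (simp add: esym_insert sum.distrib sum_distrib_left flip: sum_shift_int)
  then show ?case using insert by simp
qed

lemma sum_phi_in_t: "(\<Sum>n\<in>{- int l..int k}. phi_in_t k l n) = 1"
proof -
  have "(\<Sum>n\<in>{- int l..int k}. phi_in_t k l n) = (\<Sum>n\<in>{0..int (k + l)}. esym {1..k+l} n)"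
    unfolding phi_in_t_esym
    by (rule sum.reindex_bij_witness[where i = "\<lambda>n. n - int l" and j = "\<lambda>n. n + int l"]) auto
  then show ?thesis by (simp add: sum_esym)
qed

text \<open>Renaming variables renames the factors of the product; injectivity keeps them
  distinct.\<close>

lemma psubst_permute_esym:
  assumes "finite S" "inj_on \<sigma> S"
  shows "psubst (\<lambda>i. pvar (\<sigma> i)) (esym S n) = esym (\<sigma> ` S) n"
  using assms
proof (induction S arbitrary: n)
  case (insert j S)
  then have "\<sigma> j \<notin> \<sigma> ` S" by auto
  with insert show ?case by (simp add: esym_insert psubst_add psubst_mult psubst_diff)
qed (simp add: esym_empty)

text \<open>At \<open>t\<^sub>j = 0\<close> the factor of \<open>j\<close> degenerates to
  \<open>u\<close>, which only shifts the index.\<close>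

lemma kill_esym:
  assumes "finite S" "j \<notin> S"
  shows "kill j (esym (insert j S) n) = esym S (n - 1)"
proof -
  have *: "kill j (esym S m) = esym S m" for m
    using mpoly_vars_esym[OF assms(1)] assms by (intro kill_idem) auto
  show ?thesis
    using assms by (simp add: esym_insert kill_def psubst_add psubst_mult psubst_diff)
      (simp add: * flip: kill_def)
qed

section \<open>Euler identities: the coefficients of \<open>u E'(u)\<close> and their first- and
  second-order variants\<close>

lemma esym_euler:
  assumes "finite S"
  shows "of_int n * esym S n = (\<Sum>i\<in>S. (1 - pvar i) * esym (S - {i}) (n - 1))"
  using assms
proof (induction S arbitrary: n)
  case empty
  then show ?case by (simp add: esym_empty)
next
  case (insert j S)
  have e: "esym (insert j S - {i}) m = pvar j * esym (S - {i}) m + (1 - pvar j) * esym (S - {i}) (m - 1)"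
    if "i \<in> S" for i m
  proof -
    have "insert j S - {i} = insert j (S - {i})" using that insert by auto
    then show ?thesis using insert by (simp add: esym_insert)
  qed
  have "(\<Sum>i\<in>insert j S. (1 - pvar i) * esym (insert j S - {i}) (n - 1)) =
      (1 - pvar j) * esym S (n - 1) + (\<Sum>i\<in>S. (1 - pvar i) *
        (pvar j * esym (S - {i}) (n - 1) + (1 - pvar j) * esym (S - {i}) (n - 1 - 1)))"
    using insert by (simp add: e)
  also have "\<dots> = (1 - pvar j) * esym S (n - 1) + pvar j * (of_int n * esym S n) +
      (1 - pvar j) * (of_int (n - 1) * esym S (n - 1))"
  proof -
    have "(1 - pvar i) * (pvar j * esym (S - {i}) (n - 1) + (1 - pvar j) * esym (S - {i}) (n - 1 - 1)) =
        pvar j * ((1 - pvar i) * esym (S - {i}) (n - 1)) +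
        (1 - pvar j) * ((1 - pvar i) * esym (S - {i}) (n - 1 - 1))" for i
      by (simp only: distrib_left mult_ac)
    then show ?thesis
      unfolding insert.IH by (simp only: sum.distrib sum_distrib_left add.assoc)
  qed
  also have "\<dots> = of_int n * esym (insert j S) n"
    using insert by (simp add: esym_insert algebra_simps)
  finally show ?case by simp
qed

text \<open>Splitting off the factor of \<open>i\<close> writes \<open>e\<^sub>n\<close> as a
  \<open>t\<^sub>i\<close> part plus a \<open>1 - t\<^sub>i\<close> part. Summed over
  \<open>i\<close> this gives \<open>card S\<close> copies of \<open>e\<^sub>n\<close>, and the
  Euler identity evaluates the second part.\<close>

lemma esym_euler':
  assumes "finite S"
  shows "(\<Sum>i\<in>S. pvar i * esym (S - {i}) n) = (of_nat (card S) - of_int n) * esym S n"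
proof -
  have "(\<Sum>i\<in>S. pvar i * esym (S - {i}) n) = (\<Sum>i\<in>S. esym S n - (1 - pvar i) * esym (S - {i}) (n - 1))"
    using assms by (intro sum.cong) (auto simp: esym_remove[of S])
  then show ?thesis
    using esym_euler[OF assms, of n] by (simp add: sum_subtractf left_diff_distrib)
qed

text \<open>Weight each summand by \<open>1 = (1 - t\<^sub>i) + t\<^sub>i\<close> and apply the two
  Euler identities.\<close>

lemma sum_esym_remove:
  assumes "finite S"
  shows "(\<Sum>i\<in>S. esym (S - {i}) n) =
    of_int (n + 1) * esym S (n + 1) + (of_nat (card S) - of_int n) * esym S n"
proof -
  have "(\<Sum>i\<in>S. esym (S - {i}) n) =
      (\<Sum>i\<in>S. (1 - pvar i) * esym (S - {i}) n) + (\<Sum>i\<in>S. pvar i * esym (S - {i}) n)"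
    by (simp add: sum.distrib[symmetric] algebra_simps)
  then show ?thesis
    using esym_euler[OF assms, of "n + 1"] esym_euler'[OF assms, of n] by simp
qed

text \<open>The coefficient of index \<open>n + 1\<close> in \<open>u\<^sup>2 E''(u)\<close>,
  obtained by applying the Euler identity to \<open>S - {i}\<close> and then to
  \<open>S\<close>.\<close>

lemma sum_esym_remove2:
  assumes "finite S"
  shows "(\<Sum>i\<in>S. \<Sum>j\<in>S - {i}. (1 - pvar i) * (1 - pvar j) * esym (S - {i} - {j}) (n - 1)) =
    of_int (n + 1) * of_int n * esym S (n + 1)"
proof -
  have "(\<Sum>i\<in>S. \<Sum>j\<in>S - {i}. (1 - pvar i) * (1 - pvar j) * esym (S - {i} - {j}) (n - 1)) =
     (\<Sum>i\<in>S. (1 - pvar i) * (of_int n * esym (S - {i}) n))"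
    using assms by (intro sum.cong refl, subst esym_euler) (auto simp: sum_distrib_left mult_ac)
  also have "\<dots> = of_int n * (of_int (n + 1) * esym S (n + 1))"
    by (subst esym_euler[OF assms]) (simp add: sum_distrib_left mult_ac)
  finally show ?thesis by (simp add: mult_ac)
qed

lemma sum_esym_remove2':
  assumes "finite S"
  shows "(\<Sum>i\<in>S. \<Sum>j\<in>S - {i}. pvar i * pvar j * esym (S - {i} - {j}) n) =
    (of_nat (card S) - of_int n - 1) * (of_nat (card S) - of_int n) * esym S n"
proof -
  have "(\<Sum>i\<in>S. \<Sum>j\<in>S - {i}. pvar i * pvar j * esym (S - {i} - {j}) n) =
     (\<Sum>i\<in>S. (of_nat (card S) - of_int n - 1) * (pvar i * esym (S - {i}) n))"
  proof (intro sum.cong refl)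
    fix i assume i: "i \<in> S"
    \<comment> \<open>As \<open>S\<close> is nonempty, the truncated \<open>card S - 1\<close>
      agrees with the difference in the polynomial ring.\<close>
    then obtain d where "card S = Suc d" using assms by (cases "card S") auto
    then have c: "(of_nat (card (S - {i})) :: nat mpoly) = of_nat (card S) - 1"
      using i assms by simp
    have "(\<Sum>j\<in>S - {i}. pvar i * pvar j * esym (S - {i} - {j}) n) =
      pvar i * (\<Sum>j\<in>S - {i}. pvar j * esym (S - {i} - {j}) n)"
      by (simp add: sum_distrib_left mult_ac)
    also have "\<dots> = pvar i * ((of_nat (card S) - 1 - of_int n) * esym (S - {i}) n)"
      using assms by (subst esym_euler') (auto simp: c)
    finally show "(\<Sum>j\<in>S - {i}. pvar i * pvar j * esym (S - {i} - {j}) n) =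
       (of_nat (card S) - of_int n - 1) * (pvar i * esym (S - {i}) n)" by (simp add: algebra_simps)
  qed
  then show ?thesis by (simp only: sum_distrib_left[symmetric] esym_euler'[OF assms] mult.assoc)
qed

section \<open>Derivatives of the generators: \<open>E(u)\<close> is affine in
  \<open>t\<^sub>i\<close> with slope \<open>(1 - u) E\<^sub>i(u)\<close>\<close>

lemma pderivative_esym:
  assumes "finite S" "i \<in> S"
  shows "pderivative i (esym S n) = esym (S - {i}) n - esym (S - {i}) (n - 1)"
proof -
  have *: "pderivative i (esym (S - {i}) m) = 0" for m
    using mpoly_vars_esym[of "S - {i}" m] assms by (intro pderivative_eq_0) auto
  show ?thesis
    by (subst esym_remove[OF assms])
       (simp add: * pderivative_add pderivative_mult pderivative_diff pderivative_pvar)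
qed

lemma pderivative2_esym:
  assumes "finite S" "i \<in> S"
  shows "pderivative i (pderivative i (esym S n)) = 0"
proof -
  have *: "pderivative i (esym (S - {i}) m) = 0" for m
    using mpoly_vars_esym[of "S - {i}" m] assms by (intro pderivative_eq_0) auto
  show ?thesis
    by (simp add: pderivative_esym[OF assms] * pderivative_diff)
qed

section \<open>The Jacobi operator on the generators\<close>

text \<open>The symbol \<open>\<Gamma>(e\<^sub>a, e\<^sub>b)\<close> of the second-order
  part.\<close>

definition jac_gamma :: "nat set \<Rightarrow> int \<Rightarrow> int \<Rightarrow> nat mpoly" where
  "jac_gamma S a b = (\<Sum>i\<in>S. pvar i * (1 - pvar i) *
     pderivative i (esym S a) * pderivative i (esym S b))"

text \<open>The coefficient at \<open>u\<^sup>a v\<^sup>b\<close> of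
  \<open>u E'(u) E(v) - v E(u) E'(v)\<close>.\<close>

definition esym_comm :: "nat set \<Rightarrow> int \<Rightarrow> int \<Rightarrow> nat mpoly" where
  "esym_comm S a b = of_int (a - b) * esym S a * esym S b"

text \<open>After the Euler identity and removal of the \<open>i\<close>-th factor, the terms with
  the square of \<open>1 - t\<^sub>i\<close> cancel. The remaining factor
  \<open>t\<^sub>i (1 - t\<^sub>i)\<close> makes the sum comparable with \<open>jac_gamma\<close>
  term by term.\<close>

lemma esym_comm_sum:
  assumes "finite S"
  shows "esym_comm S a b = (\<Sum>i\<in>S. pvar i * (1 - pvar i) *
    (esym (S - {i}) (a - 1) * esym (S - {i}) b - esym (S - {i}) a * esym (S - {i}) (b - 1)))"
proof -
  have "esym_comm S a b = (of_int a * esym S a) * esym S b - (of_int b * esym S b) * esym S a"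
    by (simp add: esym_comm_def algebra_simps)
  also have "\<dots> = (\<Sum>i\<in>S. (1 - pvar i) * esym (S - {i}) (a - 1) * esym S b
      - (1 - pvar i) * esym (S - {i}) (b - 1) * esym S a)"
    by (simp only: esym_euler[OF assms] sum_subtractf sum_distrib_right)
  also have "\<dots> = (\<Sum>i\<in>S. pvar i * (1 - pvar i) *
    (esym (S - {i}) (a - 1) * esym (S - {i}) b - esym (S - {i}) a * esym (S - {i}) (b - 1)))"
  proof (intro sum.cong refl)
    fix i assume i: "i \<in> S"
    have id: "s * x1 * (t * y0 + s * y1) - s * y1 * (t * x0 + s * x1) = t * s * (x1 * y0 - x0 * y1)"
      for t s x0 x1 y0 y1 :: "nat mpoly"
      by (simp add: algebra_simps)
    show "(1 - pvar i) * esym (S - {i}) (a - 1) * esym S b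
        - (1 - pvar i) * esym (S - {i}) (b - 1) * esym S a = pvar i * (1 - pvar i) *
        (esym (S - {i}) (a - 1) * esym (S - {i}) b - esym (S - {i}) a * esym (S - {i}) (b - 1))"
      unfolding esym_remove[OF assms i] by (rule id)
  qed
  finally show ?thesis .
qed

text \<open>The coefficient at \<open>u\<^sup>a v\<^sup>b\<close> of the functional equation of the
  symbol: multiplication by \<open>u - v\<close> gives the left side, by
  \<open>(1 - u) (1 - v)\<close> the right side. It holds already for each \<open>i\<close>
  separately.\<close>

lemma jac_gamma_step:
  assumes "finite S"
  shows "jac_gamma S (a - 1) b - jac_gamma S a (b - 1) =
    esym_comm S a b - esym_comm S (a - 1) b - esym_comm S a (b - 1) + esym_comm S (a - 1) (b - 1)"
  unfolding esym_comm_sum[OF assms] jac_gamma_def sum_subtractf[symmetric] sum.distrib[symmetric]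
proof (intro sum.cong refl)
  fix i assume i: "i \<in> S"
  have id: "t * s * (x1 - x2) * (y0 - y1) - t * s * (x0 - x1) * (y1 - y2) =
    t * s * (x1 * y0 - x0 * y1) - t * s * (x2 * y0 - x1 * y1)
    - t * s * (x1 * y1 - x0 * y2) + t * s * (x2 * y1 - x1 * y2)"
    for t s x0 x1 x2 y0 y1 y2 :: "nat mpoly"
    by (simp add: algebra_simps)
  show "pvar i * (1 - pvar i) * pderivative i (esym S (a - 1)) * pderivative i (esym S b) -
      pvar i * (1 - pvar i) * pderivative i (esym S a) * pderivative i (esym S (b - 1)) =
      pvar i * (1 - pvar i) * (esym (S - {i}) (a - 1) * esym (S - {i}) b - esym (S - {i}) a * esym (S - {i}) (b - 1)) -
      pvar i * (1 - pvar i) * (esym (S - {i}) (a - 1 - 1) * esym (S - {i}) b - esym (S - {i}) (a - 1) * esym (S - {i}) (b - 1)) -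
      pvar i * (1 - pvar i) * (esym (S - {i}) (a - 1) * esym (S - {i}) (b - 1) - esym (S - {i}) a * esym (S - {i}) (b - 1 - 1)) +
      pvar i * (1 - pvar i) * (esym (S - {i}) (a - 1 - 1) * esym (S - {i}) (b - 1) - esym (S - {i}) (a - 1) * esym (S - {i}) (b - 1 - 1))"
    unfolding pderivative_esym[OF assms i] by (rule id)
qed

text \<open>The recurrence is iterated along the pairs \<open>(a + p, b - p)\<close>, whose index
  sum is constant.\<close>

lemma jac_gamma_telescope:
  assumes "finite S"
  shows "jac_gamma S a b = jac_gamma S (a + int N) (b - int N) +
    (\<Sum>p<N. esym_comm S (a + int p + 1) (b - int p) + esym_comm S (a + int p) (b - int p - 1)) -
    (\<Sum>p<N. esym_comm S (a + int p) (b - int p)) -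
    (\<Sum>p<N. esym_comm S (a + int (Suc p)) (b - int (Suc p)))"
proof (induction N)
  case (Suc N)
  have e: "a + int (Suc N) = a + int N + 1" "b - int (Suc N) = b - int N - 1" by simp_all
  have comb: "g + A - B - C = g' + (A + (x + w)) - (B + y) - (C + z)"
    if "g - g' = x - y - z + w" for g g' A B C x y z w :: "nat mpoly"
    using that by (simp add: algebra_simps)
  have "jac_gamma S (a + int N) (b - int N) - jac_gamma S (a + int N + 1) (b - int N - 1) =
      esym_comm S (a + int N + 1) (b - int N) - esym_comm S (a + int N) (b - int N)
      - esym_comm S (a + int N + 1) (b - int N - 1) + esym_comm S (a + int N) (b - int N - 1)"
    using jac_gamma_step[OF assms, of "a + int N + 1" "b - int N"] by simp
  from comb[OF this] Suc.IH show ?case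
    unfolding sum.lessThan_Suc e by (rule trans[rotated])
qed simp

text \<open>Once the first index exceeds \<open>card S\<close> the remaining symbol vanishes, and
  the telescoped sum is complete. The result is the formula for \<open>A\<close> with each variable
  replaced by a generator.\<close>

lemma jac_gamma_eq:
  assumes "finite S" "int (card S) < a + int N"
  shows "jac_gamma S a b =
    (\<Sum>p<N. of_int (a - b + 2 * int p + 1) *
        (esym S (a + int p + 1) * esym S (b - int p) + esym S (a + int p) * esym S (b - int p - 1)))
    - of_int (a - b) * (esym S a * esym S b)
    - 2 * (\<Sum>p=1..<N. of_int (a - b + 2 * int p) * (esym S (a + int p) * esym S (b - int p)))"
proof -
  define d where "d = (\<lambda>p. esym_comm S (a + int p) (b - int p))"
  have N: "d N = 0" and g: "jac_gamma S (a + int N) (b - int N) = 0"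
    using assms by (simp_all add: d_def esym_comm_def jac_gamma_def esym_eq_0)
  have d: "d p = of_int (a - b + 2 * int p) * (esym S (a + int p) * esym S (b - int p))" for p
    by (simp add: d_def esym_comm_def algebra_simps)
  \<comment> \<open>The two diagonal sums overlap in the indices from 1 to \<open>N - 1\<close>,
    whence the factor 2, while \<open>d 0\<close> occurs once. For \<open>N = 0\<close> the identity
    holds because \<open>d 0\<close> is then the vanishing \<open>d N\<close>.\<close>
  have sums: "(\<Sum>p<N. d p) + (\<Sum>p<N. d (Suc p)) = d 0 + 2 * (\<Sum>p=1..<N. d p) + d N"
  proof -
    have S: "(\<Sum>p<Suc n. d p) + (\<Sum>p<Suc n. d (Suc p)) = d 0 + 2 * (\<Sum>p=1..<Suc n. d p) + d (Suc n)" for n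
      by (induction n) (simp_all add: algebra_simps)
    show ?thesis
    proof (cases N)
      case 0
      then show ?thesis using N by simp
    next
      case (Suc n)
      show ?thesis unfolding Suc by (rule S)
    qed
  qed
  have e: "esym_comm S (a + int p + 1) (b - int p) + esym_comm S (a + int p) (b - int p - 1) =
    of_int (a - b + 2 * int p + 1) *
        (esym S (a + int p + 1) * esym S (b - int p) + esym S (a + int p) * esym S (b - int p - 1))" for p
    by (simp add: esym_comm_def algebra_simps)
  have "jac_gamma S a b =
    (\<Sum>p<N. of_int (a - b + 2 * int p + 1) *
        (esym S (a + int p + 1) * esym S (b - int p) + esym S (a + int p) * esym S (b - int p - 1)))
    - ((\<Sum>p<N. d p) + (\<Sum>p<N. d (Suc p)))"
    by (subst jac_gamma_telescope[OF assms(1), of _ _ N]) (simp add: g e d_def)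
  then show ?thesis
    unfolding sums N by (simp add: d[of 0] d)
qed

section \<open>The first-order part of the Jacobi operator\<close>

lemma sum_offdiag_swap:
  assumes "finite S"
  shows "(\<Sum>i\<in>S. \<Sum>j\<in>S - {i}. F i j) = (\<Sum>i\<in>S. \<Sum>j\<in>S - {i}. F j i :: 'a::comm_monoid_add)"
proof -
  have *: "(\<Sum>i\<in>S. \<Sum>j\<in>S - {i}. G i j) = (\<Sum>i\<in>S. \<Sum>j\<in>S. if i = j then 0 else G i j)" for G :: "_ \<Rightarrow> _ \<Rightarrow> 'a"
    using assms by (intro sum.cong refl sum.mono_neutral_cong_left) auto
  show ?thesis
    unfolding * by (subst sum.swap) (intro sum.cong refl, auto)
qed

text \<open>The poles cancel in pairs: the contributions of \<open>(i, j)\<close> and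
  \<open>(j, i)\<close> have opposite denominators, and the difference of their numerators is
  divisible by \<open>t\<^sub>i - t\<^sub>j\<close>.\<close>

lemma jacobi_pair_sum:
  assumes "finite S"
  shows "(\<Sum>i\<in>S. (\<Sum>j\<in>S - {i}. to_fract (2 * pvar i * (1 - pvar i)) / to_fract (pvar i - pvar j)) *
      to_fract (esym (S - {i}) n)) =
    to_fract (\<Sum>i\<in>S. \<Sum>j\<in>S - {i}. (1 - pvar i) * (1 - pvar j) * esym (S - {i} - {j}) (n - 1)
      - pvar i * pvar j * esym (S - {i} - {j}) n)"
proof -
  define F where "F = (\<lambda>i j. to_fract (pvar i * (1 - pvar i) * esym (S - {i}) n) / to_fract (pvar i - pvar j))"
  have FF: "F i j + F j i = to_fract ((1 - pvar i) * (1 - pvar j) * esym (S - {i} - {j}) (n - 1)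
      - pvar i * pvar j * esym (S - {i} - {j}) n)" if ij: "i \<in> S" "j \<in> S" "i \<noteq> j" for i j
  proof -
    define D where "D = (1 - pvar i) * (1 - pvar j) * esym (S - {i} - {j}) (n - 1)
      - pvar i * pvar j * esym (S - {i} - {j}) n"
    have "mono_var i \<noteq> mono_var j" using ij(3) by (metis keys_mono_var singleton_inject)
    then have ne: "pvar i - pvar j \<noteq> (0 :: nat mpoly)"
      by (auto simp: pvar_def dest: arg_cong[of _ _ "\<lambda>p. lookup p (mono_var i)"] simp: lookup_single)
    have ei: "esym (S - {i}) n = pvar j * esym (S - {i} - {j}) n + (1 - pvar j) * esym (S - {i} - {j}) (n - 1)"
      using assms ij by (intro esym_remove) auto
    have ej: "esym (S - {j}) n = pvar i * esym (S - {i} - {j}) n + (1 - pvar i) * esym (S - {i} - {j}) (n - 1)"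
      using assms ij by (subst esym_remove[of _ i]) (auto simp: Diff_insert2[symmetric] insert_commute)
    \<comment> \<open>Both numerators are expressed through the variables other than
      \<open>i\<close> and \<open>j\<close>; the common factor then splits off.\<close>
    have "pvar i * (1 - pvar i) * esym (S - {i}) n - pvar j * (1 - pvar j) * esym (S - {j}) n =
       (pvar i - pvar j) * D"
      unfolding ei ej D_def by (simp add: algebra_simps)
    then have XY: "to_fract (pvar i * (1 - pvar i) * esym (S - {i}) n) - to_fract (pvar j * (1 - pvar j) * esym (S - {j}) n)
        = to_fract (pvar i - pvar j) * to_fract D"
      by (simp only: to_fract_diff[symmetric] to_fract_mult[symmetric])
    have Fji: "F j i = - (to_fract (pvar j * (1 - pvar j) * esym (S - {j}) n) / to_fract (pvar i - pvar j))"
    proof -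
      have "to_fract (pvar j - pvar i :: nat mpoly) = - to_fract (pvar i - pvar j)" by simp
      then show ?thesis by (simp only: F_def minus_divide_right)
    qed
    have T: "to_fract (pvar i - pvar j :: nat mpoly) \<noteq> 0" using ne by simp
    have "F i j + F j i = (to_fract (pvar i * (1 - pvar i) * esym (S - {i}) n)
        - to_fract (pvar j * (1 - pvar j) * esym (S - {j}) n)) / to_fract (pvar i - pvar j)"
      by (simp only: Fji diff_divide_distrib) (simp only: F_def add_uminus_conv_diff)
    also have "\<dots> = to_fract D"
      unfolding XY by (rule nonzero_mult_div_cancel_left[OF T])
    finally have "F i j + F j i = to_fract D" .
    then show ?thesis unfolding D_def .
  qed
  have "(\<Sum>i\<in>S. (\<Sum>j\<in>S - {i}. to_fract (2 * pvar i * (1 - pvar i)) / to_fract (pvar i - pvar j)) *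
      to_fract (esym (S - {i}) n)) = (\<Sum>i\<in>S. \<Sum>j\<in>S - {i}. F i j + F i j)"
    unfolding sum_distrib_right
  proof (intro sum.cong refl)
    fix i j
    have 2: "2 * pvar i * (1 - pvar i) * esym (S - {i}) n =
        pvar i * (1 - pvar i) * esym (S - {i}) n + pvar i * (1 - pvar i) * esym (S - {i}) n"
      by (simp only: mult_2 distrib_right)
    show "to_fract (2 * pvar i * (1 - pvar i)) / to_fract (pvar i - pvar j) * to_fract (esym (S - {i}) n) =
        F i j + F i j"
      by (simp only: times_divide_eq_left to_fract_mult[symmetric] 2 to_fract_add add_divide_distrib F_def)
  qed
  \<comment> \<open>The factor 2 supplies two copies of each term; in one of them \<open>i\<close>
    and \<open>j\<close> are exchanged to form the pairs.\<close>
  also have "\<dots> = (\<Sum>i\<in>S. \<Sum>j\<in>S - {i}. F i j) + (\<Sum>i\<in>S. \<Sum>j\<in>S - {i}. F j i)"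
    unfolding sum.distrib by (subst (2) sum_offdiag_swap[OF assms]) simp
  also have "\<dots> = (\<Sum>i\<in>S. \<Sum>j\<in>S - {i}. F i j + F j i)"
    by (simp add: sum.distrib)
  also have "\<dots> = (\<Sum>i\<in>S. \<Sum>j\<in>S - {i}. to_fract ((1 - pvar i) * (1 - pvar j) * esym (S - {i} - {j}) (n - 1)
      - pvar i * pvar j * esym (S - {i} - {j}) n))"
    by (intro sum.cong refl FF) auto
  finally show ?thesis by (simp only: to_fract_sum)
qed

text \<open>The coefficient of the first derivative in the Jacobi operator, for an arbitrary set of
  variables.\<close>

definition jacobi_drift :: "nat set \<Rightarrow> complex \<Rightarrow> complex \<Rightarrow> nat \<Rightarrow> nat mpoly fract" where
  "jacobi_drift S a b i = to_fract (pconst (b + 1) - pconst (a + b + 2) * pvar i)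
        + (\<Sum>j\<in>S - {i}. to_fract (2 * pvar i * (1 - pvar i)) / to_fract (pvar i - pvar j))"

text \<open>The derivative of a generator is a difference of two polynomials
  \<open>esym (S - {i})\<close>. Pairing the drift with just one of them leaves only two terms, by
  the first- and second-order Euler identities.\<close>

lemma jacobi_drift_sum:
  assumes "finite S"
  shows "(\<Sum>i\<in>S. jacobi_drift S a b i * to_fract (esym (S - {i}) n)) =
    to_fract (pconst ((of_int n + 1) * (of_int n + b + 1)) * esym S (n + 1)
      - pconst ((of_nat (card S) - of_int n) * (of_nat (card S) - of_int n + a)) * esym S n)"
proof -
  let ?m = "of_nat (card S) :: nat mpoly"
  have "(\<Sum>i\<in>S. (pconst (b + 1) - pconst (a + b + 2) * pvar i) * esym (S - {i}) n) =
    pconst (b + 1) * (\<Sum>i\<in>S. esym (S - {i}) n)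
    - pconst (a + b + 2) * (\<Sum>i\<in>S. pvar i * esym (S - {i}) n)"
    by (simp only: left_diff_distrib sum_subtractf mult.assoc sum_distrib_left)
  then have 1: "(\<Sum>i\<in>S. (pconst (b + 1) - pconst (a + b + 2) * pvar i) * esym (S - {i}) n) =
    pconst (b + 1) * (of_int (n + 1) * esym S (n + 1) + (?m - of_int n) * esym S n)
    - pconst (a + b + 2) * ((?m - of_int n) * esym S n)"
    by (simp only: sum_esym_remove[OF assms] esym_euler'[OF assms])
  have "(\<Sum>i\<in>S. jacobi_drift S a b i * to_fract (esym (S - {i}) n)) =
    to_fract (\<Sum>i\<in>S. (pconst (b + 1) - pconst (a + b + 2) * pvar i) * esym (S - {i}) n) +
    to_fract (of_int (n + 1) * of_int n * esym S (n + 1) - (?m - of_int n - 1) * (?m - of_int n) * esym S n)"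
    unfolding jacobi_drift_def distrib_right sum.distrib jacobi_pair_sum[OF assms]
      sum_subtractf sum_esym_remove2[OF assms] sum_esym_remove2'[OF assms]
    by (simp only: to_fract_sum to_fract_mult)
  also have "\<dots> = to_fract (pconst (b + 1) * (of_int (n + 1) * esym S (n + 1) + (?m - of_int n) * esym S n)
    - pconst (a + b + 2) * ((?m - of_int n) * esym S n) +
     (of_int (n + 1) * of_int n * esym S (n + 1) - (?m - of_int n - 1) * (?m - of_int n) * esym S n))"
    by (simp only: 1 to_fract_add)
  also have "pconst (b + 1) * (of_int (n + 1) * esym S (n + 1) + (?m - of_int n) * esym S n)
    - pconst (a + b + 2) * ((?m - of_int n) * esym S n) +
     (of_int (n + 1) * of_int n * esym S (n + 1) - (?m - of_int n - 1) * (?m - of_int n) * esym S n) =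
     pconst ((of_int n + 1) * (of_int n + b + 1)) * esym S (n + 1)
      - pconst ((of_nat (card S) - of_int n) * (of_nat (card S) - of_int n + a)) * esym S n"
  proof -
    have two: "pconst 2 = (2 :: nat mpoly)" using pconst_of_nat[of 2] by simp
    have id: "(B + 1) * ((N + 1) * y + (M - N) * x) - (A + B + 2) * ((M - N) * x) +
        ((N + 1) * N * y - (M - N - 1) * (M - N) * x) =
        (N + 1) * (N + B + 1) * y - (M - N) * (M - N + A) * x" for A B N M x y :: "nat mpoly"
      by (simp add: algebra_simps)
    show ?thesis
      by (simp add: pconst_add pconst_mult pconst_diff pconst_of_nat pconst_of_int two id)
  qed
  finally show ?thesis .
qed

text \<open>The difference of the preceding formula at \<open>n\<close> and at \<open>n - 1\<close>.
  The three terms have the shape of \<open>B\<^sub>n\<close>, up to the shift of the index by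
  \<open>l\<close>.\<close>

lemma jacobi_drift_esym:
  assumes "finite S"
  shows "(\<Sum>i\<in>S. jacobi_drift S a b i * to_fract (pderivative i (esym S n))) =
    to_fract (pconst ((of_int n + 1) * (of_int n + b + 1)) * esym S (n + 1)
      + pconst ((of_nat (card S) - of_int n + 1) * (of_nat (card S) - of_int n + 1 + a)) * esym S (n - 1)
      - pconst ((of_nat (card S) - of_int n) * (of_nat (card S) - of_int n + a) + of_int n * (of_int n + b)) * esym S n)"
proof -
  have "(\<Sum>i\<in>S. jacobi_drift S a b i * to_fract (pderivative i (esym S n))) =
    (\<Sum>i\<in>S. jacobi_drift S a b i * to_fract (esym (S - {i}) n)) -
    (\<Sum>i\<in>S. jacobi_drift S a b i * to_fract (esym (S - {i}) (n - 1)))"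
    by (simp add: pderivative_esym[OF assms] right_diff_distrib sum_subtractf)
  moreover have "(of_int (n - 1) + 1) * (of_int (n - 1) + b + 1) = of_int n * (of_int n + b)"
    by (simp add: algebra_simps)
  moreover have "(of_nat (card S) - of_int (n - 1)) * (of_nat (card S) - of_int (n - 1) + a) =
      (of_nat (card S) - of_int n + 1) * (of_nat (card S) - of_int n + 1 + a)"
    by (simp add: algebra_simps)
  moreover have "x - q * e - (p * e - y) = x + y - (q + p) * e" for x y p q e :: "nat mpoly"
    by (simp add: algebra_simps)
  ultimately show ?thesis
    by (simp only: jacobi_drift_sum[OF assms] to_fract_diff[symmetric] diff_add_cancel pconst_add)
qed

section \<open>Intertwining\<close>

lemma lookup_truncation:
  assumes "f \<in> carrier phi_ring"
  shows "lookup (truncation hi lo f) M = (if keys M \<subseteq> {lo..hi} then f M else 0)"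
  unfolding truncation_def using finite_truncation[OF assms, of lo hi] by simp

lemma mpoly_vars_truncation:
  assumes "f \<in> carrier phi_ring"
  shows "mpoly_vars (truncation hi lo f) \<subseteq> {lo..hi}"
  unfolding mpoly_vars_def
proof (rule UN_least)
  fix M assume "M \<in> keys (truncation hi lo f)"
  then have "lookup (truncation hi lo f) M \<noteq> 0" by (simp only: in_keys_iff not_False_eq_True)
  then show "keys M \<subseteq> {lo..hi}" by (simp add: lookup_truncation[OF assms] split: if_splits)
qed

text \<open>Polynomials embed into the series by their coefficient functions and serve there as
  representatives.\<close>

lemma lookup_in_phi_ring: "lookup p \<in> carrier phi_ring"
proof -
  have "mono_deg M \<le> Max (mono_deg ` keys p)" if "lookup p M \<noteq> 0" for M
    using that by (intro Max_ge) (auto simp: in_keys_iff)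
  then show ?thesis unfolding phi_ring_simps by (meson not_le)
qed

lemma phi_mult_lookup: "lookup p \<otimes>\<^bsub>phi_ring\<^esub> lookup q = lookup (p * q)"
  by (simp add: fun_eq_iff phi_ring_simps lookup_mult_splits)

lemma phi_lookup: "phi n = lookup (pvar n)"
  by (auto simp: phi_def pvar_def lookup_single when_def)

lemma truncation_add:
  assumes "f \<in> carrier phi_ring" "g \<in> carrier phi_ring"
  shows "truncation hi lo (f \<oplus>\<^bsub>phi_ring\<^esub> g) = truncation hi lo f + truncation hi lo g"
  by (intro poly_mapping_eqI)
     (simp add: lookup_truncation assms phi_add_closed lookup_add phi_ring_simps(5))

text \<open>A monomial lies in the window exactly when both parts of each of its splittings do, so
  truncation respects the convolution.\<close>

lemma truncation_mult:
  assumes "f \<in> carrier phi_ring" "g \<in> carrier phi_ring"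
  shows "truncation hi lo (f \<otimes>\<^bsub>phi_ring\<^esub> g) = truncation hi lo f * truncation hi lo g"
proof (rule poly_mapping_eqI)
  fix M
  show "lookup (truncation hi lo (f \<otimes>\<^bsub>phi_ring\<^esub> g)) M = lookup (truncation hi lo f * truncation hi lo g) M"
  proof (cases "keys M \<subseteq> {lo..hi}")
    case True
    then show ?thesis
      unfolding lookup_mult_splits
      by (auto simp: lookup_truncation assms phi_mult_closed phi_ring_simps(2) keys_add_monom intro!: sum.cong)
  next
    case False
    have *: "lookup (truncation hi lo f) P * lookup (truncation hi lo g) Q = 0" if "P + Q = M" for P Q
    proof -
      have "\<not> keys P \<subseteq> {lo..hi} \<or> \<not> keys Q \<subseteq> {lo..hi}"
        using that False by (metis keys_add_monom Un_least)
      then show ?thesis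
        by (elim disjE) (simp_all add: lookup_truncation[OF assms(1)] lookup_truncation[OF assms(2)])
    qed
    have "(\<Sum>(P, Q) | P + Q = M. lookup (truncation hi lo f) P * lookup (truncation hi lo g) Q) = 0"
      by (rule sum.neutral) (use * in simp)
    then show ?thesis
      using False by (simp only: lookup_mult_splits lookup_truncation[OF phi_mult_closed[OF assms]] if_False)
  qed
qed

lemma truncation_one: "truncation hi lo \<one>\<^bsub>phi_ring\<^esub> = 1"
  by (intro poly_mapping_eqI)
     (auto simp: lookup_truncation[OF ring.ring_simprules(6)[OF cring.axioms(1)[OF cring_phi_ring]]]
       phi_ring_simps(3) lookup_one when_def)

lemma phi_deriv_closed:
  assumes "f \<in> carrier phi_ring"
  shows "phi_deriv n f \<in> carrier phi_ring"
proof -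
  obtain N where N: "\<And>M. mono_deg M > N \<Longrightarrow> f M = 0"
    using assms by (auto simp: phi_ring_simps)
  then have "\<forall>M. mono_deg M > N \<longrightarrow> phi_deriv n f M = 0"
    by (simp add: phi_deriv_def mono_deg_add)
  then show ?thesis unfolding phi_ring_simps(1) by blast
qed

text \<open>The index must lie in the window: the coefficient at \<open>M\<close> of the derivative
  is read off at \<open>M + mono_var n\<close>, which must not be truncated away.\<close>

lemma truncation_phi_deriv:
  assumes "f \<in> carrier phi_ring" "n \<in> {lo..hi}"
  shows "truncation hi lo (phi_deriv n f) = pderivative n (truncation hi lo f)"
  using assms(2) by (intro poly_mapping_eqI)
    (simp add: lookup_truncation[OF phi_deriv_closed[OF assms(1)]] lookup_truncation[OF assms(1)]
      lookup_pderivative keys_add_monom, simp add: phi_deriv_def)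

lemma coeffA_closed: "coeffA n1 n2 \<in> carrier phi_ring"
proof -
  have "coeffA n1 n2 M = 0" if "mono_deg M > 2" for M
    using that by (rule contrapos_pp) (auto elim!: coeffA_nonzeroE simp: mono_deg_add)
  then show ?thesis unfolding phi_ring_simps by blast
qed

lemma coeffB_closed: "coeffB z z' w w' n \<in> carrier phi_ring"
proof -
  have "coeffB z z' w w' n M = 0" if "mono_deg M > 1" for M
    using that by (rule contrapos_pp) (auto elim!: coeffB_nonzeroE)
  then show ?thesis unfolding phi_ring_simps by blast
qed

section \<open>Reduction of the infinite sums to the window\<close>

lemma sum'_eq_sum:
  assumes "finite W" "W \<subseteq> S" "\<And>x. x \<in> S - W \<Longrightarrow> F x = 0"
  shows "sum' F S = (sum F W :: 'a::comm_monoid_add)"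
  using sum.mono_neutral_left'[of W S F] assms by (simp add: sum.eq_sum)

lemma coeffA_mult_nonzeroE:
  assumes "(coeffA n1 n2 \<otimes>\<^bsub>phi_ring\<^esub> g) M \<noteq> 0"
  obtains a b where "a \<in> keys M" "b \<in> keys M" "n1 \<le> a" "b \<le> n2"
proof -
  obtain P Q where PQ: "P + Q = M" "coeffA n1 n2 P \<noteq> 0"
    by (rule phi_mult_nonzeroE[OF assms])
  then obtain a b where "P = mono_var a + mono_var b" "n1 \<le> a" "b \<le> n2"
    by (elim coeffA_nonzeroE)
  then show ?thesis
    using PQ(1) by (intro that[of a b]) (auto simp: keys_add_monom)
qed

text \<open>Only \<open>n = k + 1\<close> and \<open>n = - l - 1\<close> could reach into the
  window. There the relevant coefficients carry the factors \<open>n - z - 1\<close> and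
  \<open>n + w + 1\<close>, which vanish for \<open>z = k\<close> and \<open>w = l\<close>.\<close>

lemma coeffB_mult_eq_0:
  assumes "keys M \<subseteq> {- int l..int k}" "n \<notin> {- int l..int k}"
  shows "(coeffB (of_nat k) z' (of_nat l) w' n \<otimes>\<^bsub>phi_ring\<^esub> g) M = 0"
proof (rule ccontr)
  assume "\<not> ?thesis"
  then obtain P Q where PQ: "P + Q = M" "coeffB (of_nat k) z' (of_nat l) w' n P \<noteq> 0"
    by (auto elim: phi_mult_nonzeroE)
  then obtain a where a: "P = mono_var a" "a - 1 \<le> n" "n \<le> a + 1"
    by (elim coeffB_nonzeroE)
  have inj: "mono_var b = mono_var c \<longleftrightarrow> b = c" for b c :: int
    by (metis keys_mono_var singleton_inject)
  have "a \<in> {- int l..int k}" using PQ(1) a assms(1) by (auto simp: keys_add_monom)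
  with a assms(2) consider "a = int k" "n = int k + 1" | "a = - int l" "n = - int l - 1"
    by force
  then show False
    using PQ(2) by cases (simp_all add: a coeffB_def phi_def inj)
qed

text \<open>Derivatives with respect to variables outside the window do not survive truncation, for
  \<open>A\<close> by the support of its monomials and for \<open>B\<close> by the choice of
  \<open>z\<close> and \<open>w\<close>. Hence the truncated image depends only on the truncation of
  \<open>f\<close>.\<close>

lemma truncation_opD:
  fixes k l :: nat
  defines "W \<equiv> {- int l..int k}"
  assumes f: "f \<in> carrier phi_ring"
  defines "t \<equiv> truncation (int k) (- int l)"
  shows "t (opD (of_nat k) z' (of_nat l) w' f) =
    (\<Sum>n\<in>W. t (coeffA n n) * pderivative n (pderivative n (t f))) +
    2 * (\<Sum>(n1, n2)\<in>{(n1, n2). n1 \<in> W \<and> n2 \<in> W \<and> n1 > n2}.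
       t (coeffA n1 n2) * pderivative n1 (pderivative n2 (t f))) +
    (\<Sum>n\<in>W. t (coeffB (of_nat k) z' (of_nat l) w' n) * pderivative n (t f))"
proof (rule poly_mapping_eqI)
  fix M
  let ?B = "coeffB (of_nat k) z' (of_nat l) w'"
  let ?L = "{(n1, n2). n1 \<in> W \<and> n2 \<in> W \<and> n1 > n2}"
  have finL: "finite ?L"
    by (rule finite_subset[of _ "W \<times> W"]) (auto simp: W_def)
  have t: "lookup (t g) M = (if keys M \<subseteq> W then g M else 0)" if "g \<in> carrier phi_ring" for g
    unfolding t_def W_def using that by (rule lookup_truncation)
  have tA: "lookup (t (coeffA n1 n2) * pderivative n1 (pderivative n2 (t f))) M =
      (if keys M \<subseteq> W then (coeffA n1 n2 \<otimes>\<^bsub>phi_ring\<^esub> phi_deriv n1 (phi_deriv n2 f)) M else 0)"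
    if "n1 \<in> W" "n2 \<in> W" for n1 n2
  proof -
    have "t (coeffA n1 n2) * pderivative n1 (pderivative n2 (t f)) =
        t (coeffA n1 n2 \<otimes>\<^bsub>phi_ring\<^esub> phi_deriv n1 (phi_deriv n2 f))"
      using that unfolding t_def W_def
      by (simp add: truncation_mult truncation_phi_deriv coeffA_closed phi_deriv_closed f)
    then show ?thesis by (simp add: t phi_mult_closed coeffA_closed phi_deriv_closed f)
  qed
  have tB: "lookup (t (?B n) * pderivative n (t f)) M =
      (if keys M \<subseteq> W then (?B n \<otimes>\<^bsub>phi_ring\<^esub> phi_deriv n f) M else 0)"
    if "n \<in> W" for n
  proof -
    have "t (?B n) * pderivative n (t f) = t (?B n \<otimes>\<^bsub>phi_ring\<^esub> phi_deriv n f)"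
      using that unfolding t_def W_def
      by (simp add: truncation_mult truncation_phi_deriv coeffB_closed phi_deriv_closed f)
    then show ?thesis by (simp add: t phi_mult_closed coeffB_closed phi_deriv_closed f)
  qed
  have two: "lookup (2 * p) M = 2 * lookup p M" for p :: "int mpoly"
    by (simp only: mult_2 lookup_add)
  have rhs: "lookup ((\<Sum>n\<in>W. t (coeffA n n) * pderivative n (pderivative n (t f))) +
    2 * (\<Sum>(n1, n2)\<in>?L. t (coeffA n1 n2) * pderivative n1 (pderivative n2 (t f))) +
    (\<Sum>n\<in>W. t (?B n) * pderivative n (t f))) M =
    (if keys M \<subseteq> W then
      (\<Sum>n\<in>W. (coeffA n n \<otimes>\<^bsub>phi_ring\<^esub> phi_deriv n (phi_deriv n f)) M) +
      2 * (\<Sum>(n1, n2)\<in>?L. (coeffA n1 n2 \<otimes>\<^bsub>phi_ring\<^esub> phi_deriv n1 (phi_deriv n2 f)) M) +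
      (\<Sum>n\<in>W. (?B n \<otimes>\<^bsub>phi_ring\<^esub> phi_deriv n f) M) else 0)"
  proof -
    have "(\<Sum>x\<in>?L. lookup (case x of (n1, n2) \<Rightarrow> t (coeffA n1 n2) * pderivative n1 (pderivative n2 (t f))) M) =
      (\<Sum>x\<in>?L. if keys M \<subseteq> W then (case x of (n1, n2) \<Rightarrow> (coeffA n1 n2 \<otimes>\<^bsub>phi_ring\<^esub> phi_deriv n1 (phi_deriv n2 f)) M) else 0)"
      by (intro sum.cong refl, clarify) (simp add: tA)
    then show ?thesis
      by (simp add: lookup_add lookup_sum two tA tB)
  qed
  show "lookup (t (opD (of_nat k) z' (of_nat l) w' f)) M =
    lookup ((\<Sum>n\<in>W. t (coeffA n n) * pderivative n (pderivative n (t f))) +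
    2 * (\<Sum>(n1, n2)\<in>?L. t (coeffA n1 n2) * pderivative n1 (pderivative n2 (t f))) +
    (\<Sum>n\<in>W. t (?B n) * pderivative n (t f))) M"
  proof (cases "keys M \<subseteq> W")
    case False
    then show ?thesis unfolding rhs by (simp add: t opD_closed f)
  next
    case True
    \<comment> \<open>Some index of \<open>M\<close> is at least \<open>n1\<close> and some index is
      at most \<open>n2\<close>; with \<open>n2 \<le> n1\<close> both are caught between the ends of
      the window.\<close>
    have in_W: "n1 \<in> W \<and> n2 \<in> W" if A: "(coeffA n1 n2 \<otimes>\<^bsub>phi_ring\<^esub> g) M \<noteq> 0" and le: "n2 \<le> n1" for n1 n2 g
    proof -
      obtain a b where "a \<in> keys M" "b \<in> keys M" "n1 \<le> a" "b \<le> n2"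
        using A by (rule coeffA_mult_nonzeroE)
      then show ?thesis using True le unfolding W_def by fastforce
    qed
    have "opD (of_nat k) z' (of_nat l) w' f M =
      (\<Sum>n\<in>W. (coeffA n n \<otimes>\<^bsub>phi_ring\<^esub> phi_deriv n (phi_deriv n f)) M) +
      2 * (\<Sum>(n1, n2)\<in>?L. (coeffA n1 n2 \<otimes>\<^bsub>phi_ring\<^esub> phi_deriv n1 (phi_deriv n2 f)) M) +
      (\<Sum>n\<in>W. (?B n \<otimes>\<^bsub>phi_ring\<^esub> phi_deriv n f) M)"
      unfolding opD_def
    proof (intro arg_cong2[where f="(+)"] arg_cong2[where f="(*)"] refl sum'_eq_sum finL)
      show "finite W" "finite W" by (simp_all add: W_def)
      show "(coeffA n n \<otimes>\<^bsub>phi_ring\<^esub> phi_deriv n (phi_deriv n f)) M = 0" if "n \<in> UNIV - W" for n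
        using that in_W[of n n] by auto
      show "(case x of (n1, n2) \<Rightarrow> (coeffA n1 n2 \<otimes>\<^bsub>phi_ring\<^esub> phi_deriv n1 (phi_deriv n2 f)) M) = 0"
        if "x \<in> {(n1, n2). n1 > n2} - ?L" for x
        using that in_W[of "fst x" "snd x"] by (cases x) auto
      show "(?B n \<otimes>\<^bsub>phi_ring\<^esub> phi_deriv n f) M = 0" if "n \<in> UNIV - W" for n
        using that True unfolding W_def by (intro coeffB_mult_eq_0) auto
    qed auto
    then show ?thesis unfolding rhs using True by (simp add: t opD_closed f)
  qed
qed

section \<open>Images of the coefficients under the identification\<close>

lemma mono_eval_eq_0:
  assumes "v \<in> keys M" "g v = 0"
  shows "mono_eval g M = (0 :: 'a::comm_semiring_1)"
proof -
  have "g v ^ lookup M v = 0" using assms by (simp add: in_keys_iff zero_power)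
  then show ?thesis unfolding mono_eval_def using assms(1) by (intro prod_zero) auto
qed

text \<open>The substitution annihilates all variables outside the window, so \<open>P\<close> may
  contain them freely. An infinite sum can thus be replaced by any convenient finite part of
  it.\<close>

lemma psubst_truncation:
  assumes "f \<in> carrier phi_ring" "\<And>v. v \<notin> {lo..hi} \<Longrightarrow> g v = 0"
    and "\<And>M. keys M \<subseteq> {lo..hi} \<Longrightarrow> f M = lookup P M"
  shows "psubst g (truncation hi lo f) = psubst g P"
proof -
  let ?S = "keys (truncation hi lo f) \<union> keys P"
  have "psubst g (truncation hi lo f) = (\<Sum>M\<in>?S. pconst (lookup (truncation hi lo f) M) * mono_eval g M)"
    by (intro psubst_superset) auto
  also have "\<dots> = (\<Sum>M\<in>?S. pconst (lookup P M) * mono_eval g M)"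
  proof (intro sum.cong refl)
    fix M
    show "pconst (lookup (truncation hi lo f) M) * mono_eval g M = pconst (lookup P M) * mono_eval g M"
    proof (cases "keys M \<subseteq> {lo..hi}")
      case True
      then show ?thesis by (simp add: lookup_truncation assms)
    next
      case False
      then obtain v where "v \<in> keys M" "v \<notin> {lo..hi}" by blast
      then show ?thesis using assms(2) by (simp add: mono_eval_eq_0)
    qed
  qed
  also have "\<dots> = psubst g P"
    by (intro psubst_superset[symmetric]) auto
  finally show ?thesis .
qed

lemma lookup_of_int_mult: "lookup (of_int c * p) M = of_int c * lookup (p :: 'v mpoly) M"
  using lookup_pconst_mult[of "of_int c" p M] by (simp add: pconst_of_int)

lemma psubst_of_int: "psubst g (of_int c) = of_int c"
  using psubst_pconst[of g "of_int c"] by (simp add: pconst_of_int)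

lemma phi_in_t_eq_0: "n \<notin> {- int l..int k} \<Longrightarrow> phi_in_t k l n = 0"
  unfolding phi_in_t_esym by (rule esym_eq_0) auto

text \<open>Under the substitution the formula for \<open>A\<close> becomes the telescoped formula
  of \<open>jac_gamma_eq\<close>, as differences of indices are unaffected by the shift by
  \<open>l\<close>.\<close>

lemma psubst_coeffA:
  fixes k l :: nat
  shows "psubst (phi_in_t k l) (truncation (int k) (- int l) (coeffA n1 n2)) =
    jac_gamma {1..k+l} (n1 + int l) (n2 + int l)"
proof -
  let ?g = "phi_in_t k l"
  \<comment> \<open>From \<open>p = N\<close> on the first index exceeds \<open>k\<close>. This ends
    both the sums for window monomials and, after the shift, those in
    \<open>jac_gamma_eq\<close>.\<close>
  define N where "N = nat (int k - n1 + 1)"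
  have N: "int k < n1 + int N" by (simp add: N_def)
  define P :: "int mpoly" where "P =
    (\<Sum>p<N. of_int (n1 - n2 + 2 * int p + 1) *
        (pvar (n1 + int p + 1) * pvar (n2 - int p) + pvar (n1 + int p) * pvar (n2 - int p - 1)))
    - of_int (n1 - n2) * (pvar n1 * pvar n2)
    - 2 * (\<Sum>p=1..<N. of_int (n1 - n2 + 2 * int p) * (pvar (n1 + int p) * pvar (n2 - int p)))"
  have two: "lookup (2 * p) M = 2 * lookup p M" for p :: "int mpoly" and M
    by (simp only: mult_2 lookup_add)
  have "coeffA n1 n2 M = lookup P M" if M: "keys M \<subseteq> {- int l..int k}" for M
  proof -
    have z: "lookup (pvar a * pvar b) M = 0" if "a > int k" for a b
    proof (rule ccontr)
      assume "\<not> ?thesis"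
      then have "M = mono_var a + mono_var b"
        using phi_mult_phi_nonzero[of a b M] by (simp add: phi_lookup phi_mult_lookup)
      then have "a \<in> keys M" by (simp add: keys_add_monom)
      then show False using M that by auto
    qed
    show ?thesis
      unfolding coeffA_def P_def phi_lookup phi_mult_lookup lookup_minus two lookup_sum
        lookup_of_int_mult lookup_add
    proof (intro arg_cong2[where f="(-)"] arg_cong2[where f="(*)"] refl sum'_eq_sum)
      fix p :: nat
      assume "p \<in> UNIV - {..<N}"
      then have "int k < n1 + int p" using N by auto
      then show "of_int (n1 - n2 + 2 * int p + 1) *
         (lookup (pvar (n1 + int p + 1) * pvar (n2 - int p)) M +
          lookup (pvar (n1 + int p) * pvar (n2 - int p - 1)) M) = (0::complex)"
        by (simp add: z)
    next
      fix p :: nat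
      assume "p \<in> {1..} - {1..<N}"
      then have "int k < n1 + int p" using N by auto
      then show "of_int (n1 - n2 + 2 * int p) *
         lookup (pvar (n1 + int p) * pvar (n2 - int p)) M = (0::complex)"
        by (simp add: z)
    qed auto
  qed
  then have "psubst ?g (truncation (int k) (- int l) (coeffA n1 n2)) = psubst ?g P"
    by (intro psubst_truncation coeffA_closed phi_in_t_eq_0) auto
  also have "\<dots> = jac_gamma {1..k+l} (n1 + int l) (n2 + int l)"
  proof -
    have two': "psubst ?g 2 = 2" using psubst_of_int[of ?g 2] by simp
    have ar: "n1 + int l - (n2 + int l) = n1 - n2" by simp
    have ar1: "n1 + int p + 1 + int l = n1 + int l + int p + 1"
      "n1 + int p + int l = n1 + int l + int p" "n2 - int p + int l = n2 + int l - int p"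
      "n2 - int p - 1 + int l = n2 + int l - int p - 1" for p by simp_all
    have "int (card {1..k+l}) < n1 + int l + int N" using N by simp
    then show ?thesis
      unfolding P_def
      by (simp only: jac_gamma_eq[OF finite_atLeastAtMost] psubst_diff two' psubst_sum psubst_mult
          psubst_add psubst_of_int psubst_pvar phi_in_t_esym ar ar1)
  qed
  finally show ?thesis .
qed

text \<open>The drift on the generator of index \<open>n + l\<close> in \<open>k + l\<close>
  variables has the coefficients of \<open>B\<^sub>n\<close>. Matching these three coefficients is
  what fixes \<open>a = z' - k\<close> and \<open>b = w' - l\<close>.\<close>

lemma psubst_coeffB:
  fixes k l :: nat
  shows "to_fract (psubst (phi_in_t k l) (truncation (int k) (- int l) (coeffB (of_nat k) z' (of_nat l) w' n))) =
    (\<Sum>i\<in>{1..k+l}. jacobi_drift {1..k+l} (z' - of_nat k) (w' - of_nat l) i * to_fract (pderivative i (phi_in_t k l n)))"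
proof -
  let ?g = "phi_in_t k l"
  define P :: "int mpoly" where "P =
     pconst ((of_int n + of_nat l + 1) * (of_int n + w' + 1)) * pvar (n + 1)
     + pconst ((of_int n - of_nat k - 1) * (of_int n - z' - 1)) * pvar (n - 1)
     - pconst ((of_int n - of_nat k) * (of_int n - z') + (of_int n + of_nat l) * (of_int n + w')) * pvar n"
  have "coeffB (of_nat k) z' (of_nat l) w' n M = lookup P M" for M
    by (simp add: P_def coeffB_def phi_lookup lookup_minus lookup_add lookup_pconst_mult)
  then have "psubst ?g (truncation (int k) (- int l) (coeffB (of_nat k) z' (of_nat l) w' n)) = psubst ?g P"
    by (intro psubst_truncation coeffB_closed phi_in_t_eq_0) auto
  also have "\<dots> =
    pconst ((of_int n + of_nat l + 1) * (of_int n + w' + 1)) * esym {1..k+l} (n + int l + 1)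
     + pconst ((of_int n - of_nat k - 1) * (of_int n - z' - 1)) * esym {1..k+l} (n + int l - 1)
     - pconst ((of_int n - of_nat k) * (of_int n - z') + (of_int n + of_nat l) * (of_int n + w')) * esym {1..k+l} (n + int l)"
  proof -
    have "n + 1 + int l = n + int l + 1" "n - 1 + int l = n + int l - 1" by simp_all
    then show ?thesis
      by (simp only: P_def psubst_add psubst_diff psubst_mult psubst_pconst psubst_pvar phi_in_t_esym)
  qed
  finally have *: "psubst ?g (truncation (int k) (- int l) (coeffB (of_nat k) z' (of_nat l) w' n)) = \<dots>" .
  have c1: "(of_int (n + int l) + 1) * (of_int (n + int l) + (w' - of_nat l) + 1) =
      (of_int n + of_nat l + 1) * (of_int n + w' + 1)"
    by simp
  have c2: "(of_nat (card {1..k+l}) - of_int (n + int l) + 1) *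
      (of_nat (card {1..k+l}) - of_int (n + int l) + 1 + (z' - of_nat k)) =
      (of_int n - of_nat k - 1) * (of_int n - z' - 1)"
    by (simp add: algebra_simps)
  have c3: "(of_nat (card {1..k+l}) - of_int (n + int l)) *
      (of_nat (card {1..k+l}) - of_int (n + int l) + (z' - of_nat k)) +
      of_int (n + int l) * (of_int (n + int l) + (w' - of_nat l)) =
      (of_int n - of_nat k) * (of_int n - z') + (of_int n + of_nat l) * (of_int n + w')"
    by (simp add: algebra_simps)
  show ?thesis
    unfolding * phi_in_t_esym jacobi_drift_esym[OF finite_atLeastAtMost] c1 c2 c3 ..
qed

section \<open>Comparison of the two operators by the chain rule\<close>

lemma pderivative_commute: "pderivative u (pderivative v p) = pderivative v (pderivative u p)"
  by (cases "u = v") (auto intro!: poly_mapping_eqI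
    simp: lookup_pderivative lookup_add mono_var_def lookup_single when_def add_ac mult_ac)

lemma jac_gamma_commute: "jac_gamma S a b = jac_gamma S b a"
  by (simp add: jac_gamma_def mult_ac)

text \<open>Separates the second-order part, which is polynomial, from the drift with its
  denominators.\<close>

lemma jacobi_op_alt:
  "jacobi_op m a b f = to_fract (\<Sum>i\<in>{1..m}. pvar i * (1 - pvar i) * pderivative i (pderivative i f)) +
    (\<Sum>i\<in>{1..m}. jacobi_drift {1..m} a b i * to_fract (pderivative i f))"
  unfolding jacobi_op_def jacobi_drift_def to_fract_sum sum.distrib[symmetric]
  by (simp only: to_fract_mult)

text \<open>The chain rule yields a sum over all pairs of indices, the operator on series only the
  diagonal and twice the strict triangle.\<close>

lemma sum_square_triangle:
  fixes F :: "int \<Rightarrow> int \<Rightarrow> 'a::comm_semiring_1"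
  assumes "finite W" "\<And>x y. F x y = F y x"
  shows "(\<Sum>x\<in>W. \<Sum>y\<in>W. F x y) = (\<Sum>x\<in>W. F x x) +
    2 * (\<Sum>(x, y)\<in>{(x, y). x \<in> W \<and> y \<in> W \<and> x > y}. F x y)"
proof -
  let ?L = "{(x, y). x \<in> W \<and> y \<in> W \<and> x > y}"
  let ?U = "{(x, y). x \<in> W \<and> y \<in> W \<and> x < y}"
  let ?D = "(\<lambda>x. (x, x)) ` W"
  have sub: "?L \<subseteq> W \<times> W" "?U \<subseteq> W \<times> W" by auto
  then have fin: "finite ?L" "finite ?U" "finite ?D"
    using assms(1) by (auto intro: finite_subset)
  have "(\<Sum>x\<in>W. \<Sum>y\<in>W. F x y) = (\<Sum>(x, y)\<in>W \<times> W. F x y)"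
    using assms(1) by (simp add: sum.cartesian_product)
  also have "W \<times> W = ?D \<union> (?L \<union> ?U)" by auto
  also have "(\<Sum>(x, y)\<in>\<dots>. F x y) = (\<Sum>(x, y)\<in>?D. F x y) + ((\<Sum>(x, y)\<in>?L. F x y) + (\<Sum>(x, y)\<in>?U. F x y))"
    by (subst sum.union_disjoint, use fin in auto)+
  also have "(\<Sum>(x, y)\<in>?U. F x y) = (\<Sum>(x, y)\<in>?L. F x y)"
    by (rule sum.reindex_bij_witness[where i = prod.swap and j = prod.swap]) (auto simp: assms(2))
  also have "(\<Sum>(x, y)\<in>?D. F x y) = (\<Sum>x\<in>W. F x x)"
    by (subst sum.reindex) (auto simp: inj_on_def)
  finally show ?thesis by (simp only: mult_2)
qed

text \<open>The intertwining relation. By the chain rule the two operators agree as soon as their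
  symbols and their values on the generators agree.\<close>

lemma psubst_opD:
  fixes k l :: nat
  assumes f: "f \<in> carrier phi_ring"
  shows "to_fract (psubst (phi_in_t k l) (truncation (int k) (- int l) (opD (of_nat k) z' (of_nat l) w' f))) =
    jacobi_op (k + l) (z' - of_nat k) (w' - of_nat l) (psubst (phi_in_t k l) (truncation (int k) (- int l) f))"
proof -
  define W where "W = {- int l..int k}"
  define t where "t = truncation (int k) (- int l)"
  define g where "g = phi_in_t k l"
  define S where "S = {1..k+l}"
  let ?B = "coeffB (of_nat k) z' (of_nat l) w'"
  let ?dr = "jacobi_drift S (z' - of_nat k) (w' - of_nat l)"
  define D where "D = (\<lambda>n. psubst g (pderivative n (t f)))"
  define D2 where "D2 = (\<lambda>n1 n2. psubst g (pderivative n1 (pderivative n2 (t f))))"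
  define G where "G = (\<lambda>n1 n2. jac_gamma S (n1 + int l) (n2 + int l))"
  have fW: "finite W" by (simp add: W_def)
  have vW: "mpoly_vars (t f) \<subseteq> W"
    unfolding t_def W_def by (rule mpoly_vars_truncation[OF f])
  have d1: "pderivative i (psubst g (t f)) = (\<Sum>n\<in>W. D n * pderivative i (g n))" for i
    unfolding D_def by (rule pderivative_psubst[OF vW fW])
  have d1': "pderivative i (D n) = (\<Sum>n'\<in>W. D2 n' n * pderivative i (g n'))" for i n
    unfolding D_def D2_def
    by (rule pderivative_psubst[OF order_trans[OF mpoly_vars_pderivative vW] fW])
  \<comment> \<open>The generators are affine in each \<open>t\<^sub>i\<close>, so the second-order
    part contributes no first derivatives in the \<open>\<phi>\<^sub>n\<close>.\<close>
  have g2: "pderivative i (pderivative i (g n)) = 0" if "i \<in> S" for i n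
    unfolding g_def phi_in_t_esym using that by (intro pderivative2_esym) (auto simp: S_def)
  have d2: "pderivative i (pderivative i (psubst g (t f))) =
      (\<Sum>n\<in>W. \<Sum>n'\<in>W. D2 n' n * (pderivative i (g n') * pderivative i (g n)))" if "i \<in> S" for i
    unfolding d1 pderivative_sum pderivative_mult d1' g2[OF that]
    by (simp add: sum_distrib_right mult.assoc)
  have quad: "(\<Sum>i\<in>S. pvar i * (1 - pvar i) * pderivative i (pderivative i (psubst g (t f)))) =
      (\<Sum>n\<in>W. \<Sum>n'\<in>W. G n' n * D2 n' n)"
  proof -
    have "(\<Sum>i\<in>S. pvar i * (1 - pvar i) * pderivative i (pderivative i (psubst g (t f)))) =
      (\<Sum>i\<in>S. \<Sum>n\<in>W. \<Sum>n'\<in>W. pvar i * (1 - pvar i) * pderivative i (g n') * pderivative i (g n) * D2 n' n)"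
      by (intro sum.cong refl) (simp add: d2 sum_distrib_left mult_ac)
    also have "\<dots> = (\<Sum>n\<in>W. \<Sum>n'\<in>W. \<Sum>i\<in>S. pvar i * (1 - pvar i) * pderivative i (g n') * pderivative i (g n) * D2 n' n)"
      by (subst sum.swap) (intro sum.cong refl sum.swap)
    also have "\<dots> = (\<Sum>n\<in>W. \<Sum>n'\<in>W. G n' n * D2 n' n)"
      by (simp only: G_def jac_gamma_def g_def phi_in_t_esym S_def sum_distrib_right)
    finally show ?thesis .
  qed
  have drift: "(\<Sum>i\<in>S. ?dr i * to_fract (pderivative i (psubst g (t f)))) =
      to_fract (\<Sum>n\<in>W. psubst g (t (?B n)) * D n)"
  proof -
    have "(\<Sum>i\<in>S. ?dr i * to_fract (pderivative i (psubst g (t f)))) =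
      (\<Sum>i\<in>S. \<Sum>n\<in>W. ?dr i * to_fract (pderivative i (g n)) * to_fract (D n))"
      unfolding d1 to_fract_sum to_fract_mult sum_distrib_left by (simp only: mult_ac)
    also have "\<dots> = (\<Sum>n\<in>W. (\<Sum>i\<in>S. ?dr i * to_fract (pderivative i (g n))) * to_fract (D n))"
      by (subst sum.swap) (simp only: sum_distrib_right)
    also have "\<dots> = (\<Sum>n\<in>W. to_fract (psubst g (t (?B n))) * to_fract (D n))"
      by (simp only: psubst_coeffB g_def t_def S_def)
    finally show ?thesis by (simp only: to_fract_sum to_fract_mult)
  qed
  have "psubst g (t (opD (of_nat k) z' (of_nat l) w' f)) =
    (\<Sum>n\<in>W. G n n * D2 n n) +
    2 * (\<Sum>(n1, n2)\<in>{(n1, n2). n1 \<in> W \<and> n2 \<in> W \<and> n1 > n2}. G n1 n2 * D2 n1 n2) +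
    (\<Sum>n\<in>W. psubst g (t (?B n)) * D n)"
  proof -
    have A: "psubst g (t (coeffA n1 n2)) = G n1 n2" for n1 n2
      unfolding g_def t_def G_def S_def by (rule psubst_coeffA)
    have two: "psubst g 2 = 2" using psubst_of_int[of g 2] by simp
    show ?thesis
      unfolding truncation_opD[OF f, where k=k and l=l, folded W_def t_def]
      by (simp only: psubst_add two psubst_sum psubst_mult A D_def D2_def case_prod_unfold)
  qed
  also have "\<dots> = (\<Sum>n\<in>W. \<Sum>n'\<in>W. G n n' * D2 n n') + (\<Sum>n\<in>W. psubst g (t (?B n)) * D n)"
  proof -
    have "G x y * D2 x y = G y x * D2 y x" for x y
      by (simp only: G_def D2_def jac_gamma_commute[of _ "x + int l"] pderivative_commute[of x])
    from sum_square_triangle[of W "\<lambda>x y. G x y * D2 x y", OF fW this] show ?thesis by simp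
  qed
  also have "(\<Sum>n\<in>W. \<Sum>n'\<in>W. G n n' * D2 n n') = (\<Sum>n\<in>W. \<Sum>n'\<in>W. G n' n * D2 n' n)"
    by (rule sum.swap)
  finally show ?thesis
    unfolding jacobi_op_alt
    by (simp only: to_fract_add quad drift flip: g_def t_def S_def)
qed

section \<open>Generation and independence\<close>

definition deg_le :: "('v monom \<Rightarrow> nat) \<Rightarrow> nat \<Rightarrow> 'v mpoly \<Rightarrow> bool" where
  "deg_le w d p \<longleftrightarrow> (\<forall>M\<in>keys p. w M \<le> d)"

text \<open>Covers the two degrees in use: the total degree for polynomials in the
  \<open>\<phi>\<^sub>n\<close>, and the exponent of one variable for polynomials in the
  \<open>t\<^sub>i\<close>.\<close>

definition additive_weight :: "('v monom \<Rightarrow> nat) \<Rightarrow> bool" where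
  "additive_weight w \<longleftrightarrow> w 0 = 0 \<and> (\<forall>P Q. w (P + Q) = w P + w Q)"

lemma additive_weight_mono_deg: "additive_weight mono_deg"
  by (simp add: additive_weight_def mono_deg_add) (simp add: mono_deg_def)

lemma additive_weight_lookup: "additive_weight (\<lambda>M. lookup M i)"
  by (simp add: additive_weight_def lookup_add)

lemma deg_le_mono: "deg_le w d p \<Longrightarrow> d \<le> d' \<Longrightarrow> deg_le w d' p"
  by (auto simp: deg_le_def)

lemma deg_le_0 [simp]: "deg_le w d 0"
  by (simp add: deg_le_def)

lemma deg_le_add: "deg_le w d p \<Longrightarrow> deg_le w d q \<Longrightarrow> deg_le w d (p + q)"
  unfolding deg_le_def using keys_add[of p q] by blast

lemma deg_le_diff: "deg_le w d p \<Longrightarrow> deg_le w d q \<Longrightarrow> deg_le w d (p - q)"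
  using deg_le_add[of w d p "- q"] by (simp add: deg_le_def)

lemma deg_le_sum: "(\<And>x. x \<in> A \<Longrightarrow> deg_le w d (f x)) \<Longrightarrow> deg_le w d (sum f A)"
  by (induction A rule: infinite_finite_induct) (auto intro: deg_le_add)

lemma deg_le_mult:
  assumes "additive_weight w" "deg_le w d p" "deg_le w d' q"
  shows "deg_le w (d + d') (p * q)"
  unfolding deg_le_def
proof
  fix M assume "M \<in> keys (p * q)"
  then obtain P Q where "M = P + Q" "P \<in> keys p" "Q \<in> keys q"
    using keys_mult[of p q] by blast
  then show "w M \<le> d + d'"
    using assms by (auto simp: deg_le_def additive_weight_def add_mono)
qed

lemma deg_le_pconst: "additive_weight w \<Longrightarrow> deg_le w d (pconst c)"
  by (simp add: deg_le_def pconst_def additive_weight_def)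

lemma deg_le_1: "additive_weight w \<Longrightarrow> deg_le w d 1"
  using deg_le_pconst[of w d 1] by simp

lemma deg_le_power:
  assumes "additive_weight w" "deg_le w d p"
  shows "deg_le w (n * d) (p ^ n)"
  by (induction n) (use deg_le_mult[OF assms] in \<open>auto simp: deg_le_1[OF assms(1)]\<close>)

lemma deg_le_prod:
  assumes "additive_weight w" "\<And>x. x \<in> A \<Longrightarrow> deg_le w (d x) (f x)"
  shows "deg_le w (sum d A) (prod f A)"
  using assms(2)
  by (induction A rule: infinite_finite_induct) (auto simp: deg_le_1[OF assms(1)] intro!: deg_le_mult assms(1))

text \<open>Applied to the generators, which have degree at most 1 in each \<open>t\<^sub>i\<close>:
  a total degree before substitution bounds every single-variable degree after it.\<close>

lemma deg_le_psubst:
  assumes "additive_weight w" "\<And>v. v \<in> mpoly_vars p \<Longrightarrow> deg_le w 1 (g v)" "deg_le mono_deg d p"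
  shows "deg_le w d (psubst g p)"
  unfolding psubst_superset[OF finite_keys order_refl]
proof (rule deg_le_sum)
  fix M assume M: "M \<in> keys p"
  have "deg_le w (lookup M v * 1) (g v ^ lookup M v)" if "v \<in> keys M" for v
    using M that assms(2)[of v] by (intro deg_le_power assms(1)) (auto simp: mpoly_vars_def)
  then have "deg_le w (mono_deg M) (mono_eval g M)"
    unfolding mono_eval_def mono_deg_def by (intro deg_le_prod assms(1)) auto
  then have "deg_le w (0 + mono_deg M) (pconst (lookup p M) * mono_eval g M)"
    by (intro deg_le_mult deg_le_pconst assms(1))
  moreover have "mono_deg M \<le> d" using M assms(3) by (simp add: deg_le_def)
  ultimately show "deg_le w d (pconst (lookup p M) * mono_eval g M)"
    by (auto intro: deg_le_mono)
qed

lemma deg_le_notin_vars: "i \<notin> mpoly_vars p \<Longrightarrow> deg_le (\<lambda>M. lookup M i) d p"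
  by (auto simp: deg_le_def mpoly_vars_def not_in_keys_iff_lookup_eq_zero)

lemma deg_le_pvar: "deg_le (\<lambda>M. lookup M i) 1 (pvar j)"
  by (simp add: deg_le_def pvar_def mono_var_def lookup_single when_def)

lemma deg_le_esym:
  assumes "finite S"
  shows "deg_le (\<lambda>M. lookup M i) 1 (esym S n)"
proof (cases "i \<in> S")
  case False
  then show ?thesis using mpoly_vars_esym[OF assms, of n] by (intro deg_le_notin_vars) auto
next
  case True
  have *: "deg_le (\<lambda>M. lookup M i) 0 (esym (S - {i}) m)" for m
    using mpoly_vars_esym[of "S - {i}" m] assms by (intro deg_le_notin_vars) auto
  note aw = additive_weight_lookup[of i]
  have "deg_le (\<lambda>M. lookup M i) (1 + 0) (pvar i * esym (S - {i}) n)"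
    by (intro deg_le_mult aw deg_le_pvar *)
  moreover have "deg_le (\<lambda>M. lookup M i) (1 + 0) ((1 - pvar i) * esym (S - {i}) (n - 1))"
    by (intro deg_le_mult aw deg_le_pvar * deg_le_diff deg_le_1)
  ultimately show ?thesis
    unfolding esym_remove[OF assms True] by (intro deg_le_add) auto
qed

section \<open>Divisibility by \<open>e\<^sub>0\<close>, the product of all variables\<close>

lemma kill_mult: "kill v (p * q) = kill v p * kill v q"
  by (simp add: kill_def psubst_mult)

lemma kill_diff: "kill v (p - q) = kill v p - kill v q"
  by (simp add: kill_def psubst_diff)

lemma kill_psubst: "kill v (psubst g p) = psubst (\<lambda>u. kill v (g u)) p"
  by (simp add: kill_def psubst_psubst)

lemma esym_0_single:
  assumes "finite S"
  shows "esym S 0 = single (\<Sum>i\<in>S. mono_var i) 1"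
  using assms by (induction S) (auto simp: esym_empty esym_insert esym_eq_0 pvar_def mult_single)

lemma esym_0_nonzero: "finite S \<Longrightarrow> esym S 0 \<noteq> 0"
  by (simp add: esym_0_single flip: keys_eq_empty)

text \<open>Variables are split off one at a time. Setting \<open>t\<^sub>j = 0\<close> annihilates
  \<open>p\<close> but fixes the nonzero product of the other variables, so it must annihilate the
  cofactor.\<close>

lemma esym_0_dvd:
  assumes "finite S" "\<And>i. i \<in> S \<Longrightarrow> pvar i dvd p"
  shows "esym S 0 dvd p"
  using assms
proof (induction S)
  case empty
  then show ?case by (simp add: esym_empty)
next
  case (insert j S)
  then have "esym S 0 dvd p" by simp
  then obtain q where q: "p = esym S 0 * q" by blast
  have "kill j p = 0" using insert.prems[of j] by (simp add: kill_eq_0_iff)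
  moreover have "kill j (esym S 0) = esym S 0"
    using mpoly_vars_esym[OF insert.hyps(1)] insert.hyps(2) by (intro kill_idem) auto
  ultimately have "kill j q = 0"
    using esym_0_nonzero[OF insert.hyps(1)] by (simp add: q kill_mult)
  then have "pvar j dvd q" by (simp add: kill_eq_0_iff)
  then show ?case
    using insert.hyps by (simp add: q esym_insert esym_eq_0 mult.commute mult_dvd_mono)
qed

text \<open>Multiplication by a monomial translates the support, so the cofactor acquires no new
  variable and its degree in each variable of \<open>S\<close> drops by one.\<close>

lemma esym_0_mult:
  assumes "finite S" "p = esym S 0 * q"
  shows "mpoly_vars q \<subseteq> mpoly_vars p"
    and "i \<in> S \<Longrightarrow> deg_le (\<lambda>M. lookup M i) (Suc d) p \<Longrightarrow> deg_le (\<lambda>M. lookup M i) d q"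
proof -
  define P where "P = (\<Sum>i\<in>S. mono_var i)"
  have PM: "P + M \<in> keys p" if "M \<in> keys q" for M
    using that lookup_single_mult[of P 1 q M]
    by (simp add: assms esym_0_single P_def in_keys_iff)
  show "mpoly_vars q \<subseteq> mpoly_vars p"
    using PM unfolding mpoly_vars_def by (fastforce simp: keys_add_monom)
  assume i: "i \<in> S" and d: "deg_le (\<lambda>M. lookup M i) (Suc d) p"
  have "lookup P i = (\<Sum>j\<in>S. if j = i then Suc 0 else 0)"
    unfolding P_def lookup_sum by (simp add: mono_var_def lookup_single when_def)
  then have "lookup P i = 1" using i assms(1) by simp
  then show "deg_le (\<lambda>M. lookup M i) d q"
    using PM d by (fastforce simp: deg_le_def lookup_add)
qed

section \<open>Symmetric polynomials and their generation\<close>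

definition symmetric_poly :: "nat \<Rightarrow> nat mpoly \<Rightarrow> bool" where
  "symmetric_poly m p \<longleftrightarrow> (\<forall>\<sigma>. \<sigma> permutes {1..m} \<longrightarrow> psubst (\<lambda>i. pvar (\<sigma> i)) p = p)"

lemma symmetric_poly_esym: "symmetric_poly m (esym {1..m} n)"
  unfolding symmetric_poly_def
  by (auto simp: psubst_permute_esym permutes_inj_on permutes_image)

lemma symmetric_poly_psubst:
  assumes "\<And>v. symmetric_poly m (g v)"
  shows "symmetric_poly m (psubst g p)"
  using assms unfolding symmetric_poly_def by (auto simp: psubst_psubst)

lemma symmetric_poly_diff: "symmetric_poly m p \<Longrightarrow> symmetric_poly m q \<Longrightarrow> symmetric_poly m (p - q)"
  by (simp add: symmetric_poly_def psubst_diff)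

text \<open>A permutation of the first \<open>m\<close> variables fixes the last one, hence commutes
  with setting it to zero.\<close>

lemma symmetric_poly_kill:
  assumes "symmetric_poly (Suc m) p"
  shows "symmetric_poly m (kill (Suc m) p)"
  unfolding symmetric_poly_def
proof (intro allI impI)
  fix \<sigma> assume \<sigma>: "\<sigma> permutes {1..m}"
  then have \<sigma>': "\<sigma> permutes {1..Suc m}" by (rule permutes_subset) auto
  have "\<sigma> (Suc m) = Suc m" using \<sigma> by (rule permutes_not_in) auto
  then have iff: "\<sigma> i = Suc m \<longleftrightarrow> i = Suc m" for i
    using permutes_inj[OF \<sigma>] by (metis injD)
  have "psubst (\<lambda>i. pvar (\<sigma> i)) (kill (Suc m) p) = psubst (\<lambda>i. if \<sigma> i = Suc m then 0 else pvar (\<sigma> i)) p"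
    unfolding kill_def psubst_psubst by (intro psubst_cong) (auto simp: iff)
  also have "\<dots> = kill (Suc m) (psubst (\<lambda>i. pvar (\<sigma> i)) p)"
    unfolding kill_def psubst_psubst by (intro psubst_cong) auto
  also have "\<dots> = kill (Suc m) p"
    using assms \<sigma>' by (simp add: symmetric_poly_def)
  finally show "psubst (\<lambda>i. pvar (\<sigma> i)) (kill (Suc m) p) = kill (Suc m) p" .
qed

text \<open>The transposition of \<open>i\<close> and \<open>j\<close> carries one divisor to the
  other.\<close>

lemma symmetric_poly_dvd:
  assumes "symmetric_poly m p" "j \<in> {1..m}" "pvar j dvd p" "i \<in> {1..m}"
  shows "pvar i dvd p"
proof -
  obtain q where q: "p = pvar j * q" using assms(3) by blast
  have "Transposition.transpose i j permutes {1..m}"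
    using assms by (intro permutes_swap_id)
  then have "p = psubst (\<lambda>v. pvar (Transposition.transpose i j v)) p"
    using assms(1) by (simp add: symmetric_poly_def)
  then show ?thesis by (metis dvd_triv_left psubst_mult psubst_pvar q transpose_apply_second)
qed

lemma symmetric_poly_esym_0_cancel:
  assumes "symmetric_poly m p" "p = esym {1..m} 0 * q"
  shows "symmetric_poly m q"
  unfolding symmetric_poly_def
proof (intro allI impI)
  fix \<sigma> assume \<sigma>: "\<sigma> permutes {1..m}"
  have "esym {1..m} 0 * psubst (\<lambda>i. pvar (\<sigma> i)) q = psubst (\<lambda>i. pvar (\<sigma> i)) p"
    using symmetric_poly_esym[of m 0] \<sigma> by (simp add: assms(2) psubst_mult symmetric_poly_def)
  also have "\<dots> = esym {1..m} 0 * q"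
    using assms \<sigma> by (simp add: symmetric_poly_def)
  finally show "psubst (\<lambda>i. pvar (\<sigma> i)) q = q"
    using esym_0_nonzero[of "{1..m}"] by simp
qed

lemma kill_esym_Suc: "kill (Suc m) (esym {1..Suc m} n) = esym {1..m} (n - 1)"
proof -
  have "{1..Suc m} = insert (Suc m) {1..m}" by auto
  then show ?thesis by (simp only:) (rule kill_esym, auto)
qed

text \<open>Outer induction on \<open>m\<close>, inner induction on \<open>d\<close>: the
  restriction to \<open>t\<^sub>m = 0\<close> is represented in fewer variables and lifted, and the
  error is divided by \<open>e\<^sub>0\<close>. Lifting keeps the degree in each variable at most
  \<open>d\<close>, because the generators are affine in each; division lowers it. The shift
  \<open>l\<close> is general because restriction lowers the index by one.\<close>

lemma esym_generate:
  fixes l :: int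
  assumes "mpoly_vars p \<subseteq> {1..m}" "symmetric_poly m p" "\<And>i. deg_le (\<lambda>M. lookup M i) d p"
  shows "\<exists>Q. mpoly_vars Q \<subseteq> {- l..int m - l} \<and> deg_le mono_deg d Q \<and>
    psubst (\<lambda>n. esym {1..m} (n + l)) Q = p"
  using assms
proof (induction m arbitrary: p d l)
  case 0
  then have "p = pconst (lookup p 0)" by (intro mpoly_no_vars) simp
  then show ?case
    by (intro exI[of _ "pconst (lookup p 0)"]) (auto simp: deg_le_pconst additive_weight_mono_deg)
next
  case (Suc m)
  let ?S = "{1..Suc m}"
  let ?g = "\<lambda>n. esym ?S (n + l)"
  note IH_m = Suc.IH
  show ?case using Suc.prems
  proof (induction d arbitrary: p)
    case 0
    have "lookup M i = 0" if "M \<in> keys p" for M i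
      using 0(3)[of i] that by (simp add: deg_le_def)
    then have "keys M = {}" if "M \<in> keys p" for M
      using that by (metis ex_in_conv in_keys_iff)
    then have "mpoly_vars p = {}" by (simp add: mpoly_vars_def)
    then have "p = pconst (lookup p 0)" by (rule mpoly_no_vars)
    then show ?case
      by (intro exI[of _ "pconst (lookup p 0)"]) (auto simp: deg_le_pconst additive_weight_mono_deg)
  next
    case (Suc d)
    have "deg_le (\<lambda>M. lookup M i) (Suc d) (kill (Suc m) p)" for i
      using Suc.prems(3)[of i] by (auto simp: deg_le_def in_keys_iff lookup_kill split: if_splits)
    moreover have "mpoly_vars (kill (Suc m) p) \<subseteq> {1..m}"
      using mpoly_vars_kill[of "Suc m" p] Suc.prems(1) by force
    ultimately obtain Q0 where Q0: "mpoly_vars Q0 \<subseteq> {- (l - 1)..int m - (l - 1)}" "deg_le mono_deg (Suc d) Q0"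
      "psubst (\<lambda>n. esym {1..m} (n + (l - 1))) Q0 = kill (Suc m) p"
      using IH_m[of "kill (Suc m) p" "Suc d" "l - 1"] symmetric_poly_kill[OF Suc.prems(2)] by blast
    \<comment> \<open>The error of the lift. The same polynomial \<open>Q0\<close> is reused, with
      the generators of one more variable; its window lacks only the index \<open>- l\<close> of
      \<open>e\<^sub>0\<close>.\<close>
    define h where "h = p - psubst ?g Q0"
    have ke: "kill (Suc m) (?g n) = esym {1..m} (n + (l - 1))" for n
      unfolding kill_esym_Suc by (simp add: algebra_simps)
    have "kill (Suc m) h = 0"
      unfolding h_def kill_diff kill_psubst ke Q0(3) by simp
    then have dvd: "pvar (Suc m) dvd h" by (simp add: kill_eq_0_iff)
    have sym: "symmetric_poly (Suc m) h"
      unfolding h_def by (intro symmetric_poly_diff symmetric_poly_psubst symmetric_poly_esym Suc.prems)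
    have "esym ?S 0 dvd h"
      using symmetric_poly_dvd[OF sym _ dvd] by (intro esym_0_dvd) auto
    then obtain q where q: "h = esym ?S 0 * q" by blast
    have deg_h: "deg_le (\<lambda>M. lookup M i) (Suc d) h" for i
      unfolding h_def
      by (intro deg_le_diff Suc.prems deg_le_psubst additive_weight_lookup deg_le_esym Q0(2)) auto
    have "mpoly_vars (psubst ?g Q0) \<subseteq> ?S"
      by (intro mpoly_vars_psubst mpoly_vars_esym) auto
    then have "mpoly_vars h \<subseteq> ?S"
      using mpoly_vars_diff[of p "psubst ?g Q0"] Suc.prems(1) by (auto simp: h_def)
    then have vars_q: "mpoly_vars q \<subseteq> ?S"
      using esym_0_mult(1)[OF _ q] by auto
    have "deg_le (\<lambda>M. lookup M i) d q" for i
    proof (cases "i \<in> ?S")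
      case True
      then show ?thesis by (intro esym_0_mult(2)[OF _ q _ deg_h]) auto
    next
      case False
      then show ?thesis using vars_q by (intro deg_le_notin_vars) blast
    qed
    then obtain Q1 where Q1: "mpoly_vars Q1 \<subseteq> {- l..int (Suc m) - l}" "deg_le mono_deg d Q1" "psubst ?g Q1 = q"
      using Suc.IH[OF vars_q symmetric_poly_esym_0_cancel[OF sym q]] by blast
    \<comment> \<open>\<open>pvar (- l)\<close> is mapped to \<open>e\<^sub>0\<close>, so
      multiplying \<open>Q1\<close> by it restores the divided factor at the cost of one
      degree.\<close>
    have "deg_le mono_deg 1 (pvar (- l))" by (simp add: deg_le_def pvar_def)
    then have "deg_le mono_deg (1 + d) (pvar (- l) * Q1)"
      using Q1(2) by (intro deg_le_mult additive_weight_mono_deg)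
    then have "deg_le mono_deg (Suc d) (Q0 + pvar (- l) * Q1)"
      using Q0(2) by (intro deg_le_add) auto
    moreover have "mpoly_vars (Q0 + pvar (- l) * Q1) \<subseteq> {- l..int (Suc m) - l}"
      using mpoly_vars_add[of Q0 "pvar (- l) * Q1"] mpoly_vars_mult[of "pvar (- l)" Q1] Q0(1) Q1(1)
      by fastforce
    moreover have "psubst ?g (Q0 + pvar (- l) * Q1) = p"
    proof -
      have "psubst ?g (Q0 + pvar (- l) * Q1) = psubst ?g Q0 + h"
        unfolding psubst_add psubst_mult Q1(3) q psubst_pvar by simp
      then show ?thesis by (simp add: h_def)
    qed
    ultimately show ?case by blast
  qed
qed

text \<open>The top index \<open>m - l\<close> is left out, since the generators sum to 1. By
  induction on \<open>m\<close> a relation is divisible by the variable mapped to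
  \<open>e\<^sub>0\<close>; cancelling gives a relation of smaller degree, and this descent ends
  only at 0.\<close>

lemma esym_independent:
  fixes l :: int
  assumes "mpoly_vars p \<subseteq> {- l..int m - l - 1}" "psubst (\<lambda>n. esym {1..m} (n + l)) p = 0"
  shows "p = 0"
  using assms
proof (induction m arbitrary: p l)
  case 0
  then have "p = pconst (lookup p 0)" by (intro mpoly_no_vars) simp
  with 0(2) have "pconst (lookup p 0) = (0 :: nat mpoly)" by (metis psubst_pconst)
  then have "lookup p 0 = 0" by (simp add: pconst_def flip: keys_eq_empty split: if_splits)
  then show ?case using \<open>p = pconst (lookup p 0)\<close> by simp
next
  case (Suc m)
  let ?S = "{1..Suc m}"
  let ?g = "\<lambda>n. esym ?S (n + l)"
  have "deg_le mono_deg d p \<Longrightarrow> p = 0" for d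
    using Suc.prems
  proof (induction d arbitrary: p)
    have *: "\<exists>q. p = pvar (- l) * q \<and> mpoly_vars q \<subseteq> mpoly_vars p \<and> psubst ?g q = 0 \<and>
        (\<forall>M\<in>keys q. mono_var (- l) + M \<in> keys p)"
      if p: "mpoly_vars p \<subseteq> {- l..int (Suc m) - l - 1}" "psubst ?g p = 0" for p
    proof -
      let ?h = "\<lambda>n. esym {1..m} (n + (l - 1))"
      have ke: "kill (Suc m) (?g n) = ?h n" for n
        unfolding kill_esym_Suc by (simp add: algebra_simps)
      \<comment> \<open>\<open>?h (- l)\<close> is the generator of index -1, hence 0, so removing
        that variable beforehand changes nothing.\<close>
      have "psubst ?h (kill (- l) p) = psubst ?h p"
        unfolding kill_def psubst_psubst by (intro psubst_cong) (auto simp: esym_eq_0)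
      also have "\<dots> = kill (Suc m) (psubst ?g p)"
        unfolding kill_psubst ke ..
      also have "\<dots> = 0" unfolding p(2) by (simp add: kill_def)
      finally have "psubst ?h (kill (- l) p) = 0" .
      moreover have "mpoly_vars (kill (- l) p) \<subseteq> {- (l - 1)..int m - (l - 1) - 1}"
        using mpoly_vars_kill[of "- l" p] p(1) by force
      ultimately have "kill (- l) p = 0" by (intro Suc.IH)
      then have "pvar (- l) dvd p" by (simp add: kill_eq_0_iff)
      then obtain q where q: "p = pvar (- l) * q" by blast
      have k: "\<forall>M\<in>keys q. mono_var (- l) + M \<in> keys p"
        using lookup_single_mult[of "mono_var (- l)" 1 q] by (simp add: q pvar_def in_keys_iff)
      then have "mpoly_vars q \<subseteq> mpoly_vars p"
        unfolding mpoly_vars_def by (fastforce simp: keys_add_monom)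
      \<comment> \<open>The split-off variable is mapped to \<open>esym ?S 0\<close>, which is
        nonzero and can be cancelled.\<close>
      moreover have "psubst ?g q = 0"
        using p(2) esym_0_nonzero[of ?S] by (simp add: q psubst_mult)
      ultimately show ?thesis using q k by blast
    qed
    {
      case 0
      obtain q where q: "p = pvar (- l) * q" "\<forall>M\<in>keys q. mono_var (- l) + M \<in> keys p"
        using *[OF 0(2,3)] by blast
      have "M \<notin> keys q" for M
      proof
        assume "M \<in> keys q"
        then have "mono_deg (mono_var (- l) + M) \<le> 0"
          using q(2) 0(1) unfolding deg_le_def by blast
        then show False by (simp add: mono_deg_add)
      qed
      then have "keys q = {}" by blast
      then show ?case by (simp add: q(1))
    next
      case (Suc d)
      obtain q where q: "p = pvar (- l) * q" "mpoly_vars q \<subseteq> mpoly_vars p" "psubst ?g q = 0"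
        "\<forall>M\<in>keys q. mono_var (- l) + M \<in> keys p"
        using *[OF Suc.prems(2,3)] by blast
      have "deg_le mono_deg d q"
        unfolding deg_le_def
      proof
        fix M assume "M \<in> keys q"
        then have "mono_deg (mono_var (- l) + M) \<le> Suc d"
          using q(4) Suc.prems(1) unfolding deg_le_def by blast
        then show "mono_deg M \<le> d" by (simp add: mono_deg_add)
      qed
      then have "q = 0" using Suc.IH q Suc.prems by blast
      then show ?case by (simp add: q(1))
    }
  qed
  moreover have "deg_le mono_deg (Max (mono_deg ` keys p)) p"
    by (simp add: deg_le_def)
  ultimately show ?case by blast
qed

section \<open>The factor theorem and the kernel on polynomials\<close>

lemma dvd_diff_psubst_update:
  "(pvar v - r) dvd (p - psubst (\<lambda>u. if u = v then r else pvar u) p)"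
  using order_refl[of "mpoly_vars p"]
proof (induction p rule: mpoly_induct)
  case (add p q)
  then show ?case using dvd_add[OF add] by (simp add: psubst_add algebra_simps)
next
  case (mult p q)
  let ?s = "psubst (\<lambda>u. if u = v then r else pvar u)"
  have "p * q - ?s p * ?s q = p * (q - ?s q) + (p - ?s p) * ?s q" by (simp add: algebra_simps)
  then show ?case using mult by (simp add: psubst_mult)
qed auto

text \<open>Modulo the relation the top variable can be eliminated. The result has the same image
  and involves only the \<open>k + l\<close> independent variables, so it is 0; by the factor
  theorem \<open>p\<close> is then divisible by the relation.\<close>

lemma psubst_phi_in_t_kernel:
  fixes k l :: nat
  assumes "mpoly_vars p \<subseteq> {- int l..int k}" "psubst (phi_in_t k l) p = 0"
  shows "((\<Sum>n\<in>{- int l..int k}. pvar n) - 1) dvd p"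
proof -
  let ?g = "phi_in_t k l"
  have W: "{- int l..int k} = insert (int k) {- int l..int k - 1}" by auto
  define r where "r = 1 - (\<Sum>n\<in>{- int l..int k - 1}. pvar n :: int mpoly)"
  define \<eta> where "\<eta> = (\<lambda>u. if u = int k then r else pvar u)"
  have "psubst ?g r = ?g (int k)"
    using sum_phi_in_t[of k l] unfolding W by (simp add: r_def psubst_diff psubst_sum algebra_simps)
  then have "psubst ?g (psubst \<eta> p) = psubst ?g p"
    unfolding psubst_psubst by (intro psubst_cong) (auto simp: \<eta>_def)
  then have "psubst (\<lambda>n. esym {1..k+l} (n + int l)) (psubst \<eta> p) = 0"
    unfolding phi_in_t_esym[symmetric] assms(2) .
  moreover have "mpoly_vars (psubst \<eta> p) \<subseteq> {- int l..int (k + l) - int l - 1}"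
  proof (rule mpoly_vars_psubst)
    fix v assume "v \<in> mpoly_vars p"
    moreover have "mpoly_vars r \<subseteq> {- int l..int k - 1}"
      using mpoly_vars_diff[of 1 "\<Sum>n\<in>{- int l..int k - 1}. pvar n"]
        mpoly_vars_sum[of pvar "{- int l..int k - 1}"] by (auto simp: r_def)
    ultimately show "mpoly_vars (\<eta> v) \<subseteq> {- int l..int (k + l) - int l - 1}"
      using assms(1) by (auto simp: \<eta>_def)
  qed
  ultimately have "psubst \<eta> p = 0" by (intro esym_independent)
  moreover have "(\<Sum>n\<in>{- int l..int k}. pvar n) - 1 = pvar (int k) - r"
    unfolding W by (simp add: r_def)
  ultimately show ?thesis
    using dvd_diff_psubst_update[of "int k" r p] by (simp add: \<eta>_def)
qed

section \<open>The quotient algebra\<close>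

lemma sym_ring_simps:
  "p \<in> carrier (sym_ring m) \<longleftrightarrow> mpoly_vars p \<subseteq> {1..m} \<and> symmetric_poly m p"
  "p \<otimes>\<^bsub>sym_ring m\<^esub> q = p * q" "\<one>\<^bsub>sym_ring m\<^esub> = 1"
  "p \<oplus>\<^bsub>sym_ring m\<^esub> q = p + q" "\<zero>\<^bsub>sym_ring m\<^esub> = 0"
  by (auto simp: sym_ring_def mem_mpoly_ring symmetric_poly_def) (auto simp: mpoly_ring_def)

lemma ring_sym_ring: "ring (sym_ring m)"
proof (rule ringI)
  show "abelian_group (sym_ring m)"
  proof (rule abelian_groupI)
    fix p assume "p \<in> carrier (sym_ring m)"
    then show "\<exists>q\<in>carrier (sym_ring m). q \<oplus>\<^bsub>sym_ring m\<^esub> p = \<zero>\<^bsub>sym_ring m\<^esub>"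
      by (intro bexI[of _ "- p"]) (auto simp: sym_ring_simps symmetric_poly_def psubst_uminus)
  next
    fix p q assume "p \<in> carrier (sym_ring m)" "q \<in> carrier (sym_ring m)"
    then show "p \<oplus>\<^bsub>sym_ring m\<^esub> q \<in> carrier (sym_ring m)"
      using mpoly_vars_add[of p q] by (auto simp: sym_ring_simps symmetric_poly_def psubst_add)
  qed (auto simp: sym_ring_simps symmetric_poly_def add_ac)
  show "monoid (sym_ring m)"
  proof (rule monoidI)
    fix p q assume "p \<in> carrier (sym_ring m)" "q \<in> carrier (sym_ring m)"
    then show "p \<otimes>\<^bsub>sym_ring m\<^esub> q \<in> carrier (sym_ring m)"
      using mpoly_vars_mult[of p q] by (auto simp: sym_ring_simps symmetric_poly_def psubst_mult)
  qed (auto simp: sym_ring_simps symmetric_poly_def mult_ac)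
qed (auto simp: sym_ring_simps ring_distribs)

text \<open>The map on representatives that induces the identification on the quotient.\<close>

definition to_sym :: "nat \<Rightarrow> nat \<Rightarrow> phi_series \<Rightarrow> nat mpoly" where
  "to_sym k l f = psubst (phi_in_t k l) (truncation (int k) (- int l) f)"

lemma ring_hom_to_sym: "ring_hom_ring phi_ring (sym_ring (k + l)) (to_sym k l)"
proof (rule ring_hom_ringI2[OF cring.axioms(1)[OF cring_phi_ring] ring_sym_ring], rule ring_hom_memI)
  fix f assume f: "f \<in> carrier phi_ring"
  show "to_sym k l f \<in> carrier (sym_ring (k + l))"
    unfolding to_sym_def sym_ring_simps phi_in_t_esym
    by (intro conjI mpoly_vars_psubst mpoly_vars_esym symmetric_poly_psubst symmetric_poly_esym) auto
next
  fix f g assume "f \<in> carrier phi_ring" "g \<in> carrier phi_ring"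
  then show "to_sym k l (f \<otimes>\<^bsub>phi_ring\<^esub> g) = to_sym k l f \<otimes>\<^bsub>sym_ring (k + l)\<^esub> to_sym k l g"
    and "to_sym k l (f \<oplus>\<^bsub>phi_ring\<^esub> g) = to_sym k l f \<oplus>\<^bsub>sym_ring (k + l)\<^esub> to_sym k l g"
    by (simp_all add: to_sym_def sym_ring_simps truncation_mult truncation_add psubst_mult psubst_add)
qed (simp add: to_sym_def sym_ring_simps truncation_one)

lemma truncation_lookup:
  assumes "mpoly_vars p \<subseteq> {lo..hi}"
  shows "truncation hi lo (lookup p) = p"
proof (rule poly_mapping_eqI)
  fix M
  show "lookup (truncation hi lo (lookup p)) M = lookup p M"
  proof (cases "lookup p M = 0")
    case False
    then have "keys M \<subseteq> {lo..hi}" using assms unfolding mpoly_vars_def by (metis UN_subset_iff in_keys_iff)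
    then show ?thesis by (simp add: lookup_truncation[OF lookup_in_phi_ring])
  qed (simp add: lookup_truncation[OF lookup_in_phi_ring])
qed

lemma to_sym_onto: "to_sym k l ` carrier phi_ring = carrier (sym_ring (k + l))"
proof
  show "to_sym k l ` carrier phi_ring \<subseteq> carrier (sym_ring (k + l))"
    using ring_hom_closed[OF ring_hom_ring.homh[OF ring_hom_to_sym]] by blast
  show "carrier (sym_ring (k + l)) \<subseteq> to_sym k l ` carrier phi_ring"
  proof
    fix p assume p: "p \<in> carrier (sym_ring (k + l))"
    \<comment> \<open>The total degree bounds all exponents at once, which gives a single
      \<open>d\<close> valid for every \<open>i\<close>.\<close>
    have "deg_le (\<lambda>M. lookup M i) (Max (mono_deg ` keys p)) p" for i
      unfolding deg_le_def
    proof
      fix M assume "M \<in> keys p"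
      then have "mono_deg M \<le> Max (mono_deg ` keys p)" by simp
      moreover have "lookup M i \<le> mono_deg M"
        unfolding mono_deg_def by (cases "i \<in> keys M") (auto simp: not_in_keys_iff_lookup_eq_zero intro: member_le_sum)
      ultimately show "lookup M i \<le> Max (mono_deg ` keys p)" by simp
    qed
    with p obtain Q where Q: "mpoly_vars Q \<subseteq> {- int l..int (k + l) - int l}"
      "psubst (\<lambda>n. esym {1..k+l} (n + int l)) Q = p"
      using esym_generate unfolding sym_ring_simps by blast
    then have "to_sym k l (lookup Q) = p"
      unfolding to_sym_def phi_in_t_esym by (subst truncation_lookup) auto
    then show "p \<in> to_sym k l ` carrier phi_ring"
      using lookup_in_phi_ring by blast
  qed
qed

section \<open>The ideal as a kernel\<close>

lemma phi_finsum: "finite A \<Longrightarrow> (\<Oplus>\<^bsub>phi_ring\<^esub>n\<in>A. lookup (p n)) = lookup (\<Sum>n\<in>A. p n)"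
proof (induction A rule: finite_induct)
  interpret cring phi_ring by (rule cring_phi_ring)
  case empty
  then show ?case by (simp add: fun_eq_iff phi_ring_simps)
next
  interpret cring phi_ring by (rule cring_phi_ring)
  case (insert x A)
  then show ?case by (subst finsum_insert) (auto simp: lookup_in_phi_ring fun_eq_iff phi_ring_simps(5) lookup_add)
qed

lemma phi_minus:
  assumes "f \<in> carrier phi_ring" "g \<in> carrier phi_ring"
  shows "f \<ominus>\<^bsub>phi_ring\<^esub> g = (\<lambda>M. f M - g M)"
proof -
  interpret cring phi_ring by (rule cring_phi_ring)
  have "(\<lambda>M. - g M) \<in> carrier phi_ring" using assms(2) by (auto simp: phi_ring_simps(1))
  then have "\<ominus>\<^bsub>phi_ring\<^esub> g = (\<lambda>M. - g M)"
    by (intro minus_equality) (use assms in \<open>auto simp: fun_eq_iff phi_ring_simps(4,5)\<close>)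
  then show ?thesis by (simp add: a_minus_def fun_eq_iff phi_ring_simps(5))
qed

lemma truncation_minus:
  assumes "f \<in> carrier phi_ring" "g \<in> carrier phi_ring"
  shows "truncation hi lo (f \<ominus>\<^bsub>phi_ring\<^esub> g) = truncation hi lo f - truncation hi lo g"
proof -
  interpret cring phi_ring by (rule cring_phi_ring)
  have "truncation hi lo f = truncation hi lo ((f \<ominus>\<^bsub>phi_ring\<^esub> g) \<oplus>\<^bsub>phi_ring\<^esub> g)"
    using assms by (simp add: a_minus_def a_assoc l_neg)
  then show ?thesis using assms by (simp add: truncation_add)
qed

lemma phi_one: "\<one>\<^bsub>phi_ring\<^esub> = lookup 1"
  by (simp add: fun_eq_iff phi_ring_simps lookup_one when_def)

lemma phi_sum_minus_one:
  "(\<Oplus>\<^bsub>phi_ring\<^esub>n\<in>{lo..hi}. phi n) \<ominus>\<^bsub>phi_ring\<^esub> \<one>\<^bsub>phi_ring\<^esub> = lookup ((\<Sum>n\<in>{lo..hi}. pvar n) - 1)"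
  by (simp add: phi_lookup phi_finsum phi_one phi_minus lookup_in_phi_ring fun_eq_iff lookup_minus)

lemma mem_ideal_I: "f \<in> ideal_I hi lo \<longleftrightarrow> f \<in> carrier phi_ring \<and> truncation hi lo f = 0"
  by (simp add: ideal_I_def a_kernel_def' mpoly_ring_def)

lemma mem_kernel_to_sym:
  "f \<in> a_kernel phi_ring (sym_ring (k + l)) (to_sym k l) \<longleftrightarrow> f \<in> carrier phi_ring \<and> to_sym k l f = 0"
  unfolding a_kernel_def' sym_ring_simps(5) by blast

text \<open>The generators of the ideal lie in the kernel. Conversely, an element of the kernel is
  its truncation, a multiple of the relation, plus a remainder with zero truncation, which lies in
  \<open>ideal_I\<close>.\<close>

lemma ideal_J_eq_kernel:
  "ideal_J (int k) (- int l) = a_kernel phi_ring (sym_ring (k + l)) (to_sym k l)"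
proof
  interpret cring phi_ring by (rule cring_phi_ring)
  interpret h: ring_hom_ring phi_ring "sym_ring (k + l)" "to_sym k l" by (rule ring_hom_to_sym)
  let ?s = "(\<Sum>n\<in>{- int l..int k}. pvar n) - 1 :: int mpoly"
  let ?G = "insert (lookup ?s) (ideal_I (int k) (- int l))"
  let ?K = "a_kernel phi_ring (sym_ring (k + l)) (to_sym k l)"
  have J: "ideal_J (int k) (- int l) = Idl\<^bsub>phi_ring\<^esub> ?G"
    by (simp add: ideal_J_def phi_sum_minus_one)
  have K: "f \<in> ?K \<longleftrightarrow> f \<in> carrier phi_ring \<and> to_sym k l f = 0" for f
    by (rule mem_kernel_to_sym)
  have G: "?G \<subseteq> carrier phi_ring"
    by (auto simp: mem_ideal_I lookup_in_phi_ring)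
  have vars_s: "mpoly_vars ?s \<subseteq> {- int l..int k}"
    using mpoly_vars_diff[of "\<Sum>n\<in>{- int l..int k}. pvar n" 1]
      mpoly_vars_sum[of pvar "{- int l..int k}"] by auto
  have "to_sym k l (lookup ?s) = 0"
    unfolding to_sym_def truncation_lookup[OF vars_s] by (simp add: psubst_diff psubst_sum sum_phi_in_t)
  then have "?G \<subseteq> ?K"
    using K lookup_in_phi_ring by (auto simp: mem_ideal_I to_sym_def)
  then show "ideal_J (int k) (- int l) \<subseteq> ?K"
    unfolding J by (intro genideal_minimal h.kernel_is_ideal)
  show "?K \<subseteq> ideal_J (int k) (- int l)"
  proof
    interpret J: ideal "Idl\<^bsub>phi_ring\<^esub> ?G" phi_ring by (rule genideal_ideal[OF G])
    have inJ: "?G \<subseteq> Idl\<^bsub>phi_ring\<^esub> ?G" by (rule genideal_self[OF G])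
    fix f assume "f \<in> ?K"
    then have f: "f \<in> carrier phi_ring" and "to_sym k l f = 0" by (simp_all add: K)
    define p where "p = truncation (int k) (- int l) f"
    have vars_p: "mpoly_vars p \<subseteq> {- int l..int k}"
      unfolding p_def by (rule mpoly_vars_truncation[OF f])
    have "?s dvd p"
      using \<open>to_sym k l f = 0\<close> by (intro psubst_phi_in_t_kernel[OF vars_p]) (simp add: to_sym_def p_def)
    then obtain q where q: "p = ?s * q" by blast
    have "lookup p = lookup ?s \<otimes>\<^bsub>phi_ring\<^esub> lookup q"
      by (simp add: phi_mult_lookup q)
    then have 1: "lookup p \<in> Idl\<^bsub>phi_ring\<^esub> ?G"
      using inJ by (auto intro: J.I_r_closed lookup_in_phi_ring)
    have "truncation (int k) (- int l) (f \<ominus>\<^bsub>phi_ring\<^esub> lookup p) = 0"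
      by (simp add: truncation_minus f lookup_in_phi_ring truncation_lookup[OF vars_p]) (simp add: p_def)
    then have "f \<ominus>\<^bsub>phi_ring\<^esub> lookup p \<in> ideal_I (int k) (- int l)"
      by (simp add: mem_ideal_I f lookup_in_phi_ring)
    then have 2: "f \<ominus>\<^bsub>phi_ring\<^esub> lookup p \<in> Idl\<^bsub>phi_ring\<^esub> ?G"
      using inJ by blast
    have "(f \<ominus>\<^bsub>phi_ring\<^esub> lookup p) \<oplus>\<^bsub>phi_ring\<^esub> lookup p = f"
      using f lookup_in_phi_ring[of p] by (simp add: a_minus_def a_assoc l_neg)
    then show "f \<in> ideal_J (int k) (- int l)"
      unfolding J using J.a_closed[OF 2 1] by simp
  qed
qed

theorem theorem1p2:
  fixes k l :: nat and z' w' :: complex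
  assumes "k \<noteq> 0 \<or> l \<noteq> 0"
  shows "opD (of_nat k) z' (of_nat l) w' ` ideal_J (int k) (- int l) \<subseteq> ideal_J (int k) (- int l) \<and>
    identification k l \<in> ring_iso (phi_ring Quot ideal_J (int k) (- int l)) (sym_ring (k + l)) \<and>
    (\<forall>X\<in>carrier (phi_ring Quot ideal_J (int k) (- int l)).
       to_fract (identification k l
         (quot_op phi_ring (ideal_J (int k) (- int l)) (opD (of_nat k) z' (of_nat l) w') X)) =
       jacobi_op (k + l) (z' - of_nat k) (w' - of_nat l) (identification k l X))"
proof -
  interpret cring phi_ring by (rule cring_phi_ring)
  interpret h: ring_hom_ring phi_ring "sym_ring (k + l)" "to_sym k l" by (rule ring_hom_to_sym)
  define J where "J = ideal_J (int k) (- int l)"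
  define T where "T = opD (of_nat k) z' (of_nat l) w'"
  have JK: "J = a_kernel phi_ring (sym_ring (k + l)) (to_sym k l)"
    unfolding J_def by (rule ideal_J_eq_kernel)
  interpret J: ideal J phi_ring unfolding JK by (rule h.kernel_is_ideal)
  have K: "f \<in> J \<longleftrightarrow> f \<in> carrier phi_ring \<and> to_sym k l f = 0" for f
    unfolding JK by (rule mem_kernel_to_sym)
  have T_closed: "T f \<in> carrier phi_ring" if "f \<in> carrier phi_ring" for f
    unfolding T_def using that by (rule opD_closed)
  have T: "to_fract (to_sym k l (T f)) = jacobi_op (k + l) (z' - of_nat k) (w' - of_nat l) (to_sym k l f)"
    if "f \<in> carrier phi_ring" for f
    unfolding T_def to_sym_def using that by (rule psubst_opD)
  \<comment> \<open>The Jacobi operator maps 0 to 0 and \<open>to_fract\<close> is injective, so the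
    intertwining relation keeps the kernel invariant.\<close>
  have "T f \<in> J" if "f \<in> J" for f
  proof -
    have "to_fract (to_sym k l (T f)) = jacobi_op (k + l) (z' - of_nat k) (w' - of_nat l) 0"
      using that T[of f] by (simp add: K)
    also have "\<dots> = 0" by (simp add: jacobi_op_def)
    finally show ?thesis using that T_closed[of f] by (simp add: K)
  qed
  then have 1: "T ` J \<subseteq> J" by blast
  have ident: "identification k l = (\<lambda>X. the_elem (to_sym k l ` X))"
    by (simp add: fun_eq_iff identification_def to_sym_def)
  \<comment> \<open>The first isomorphism theorem; surjectivity is the generation of symmetric
    polynomials by the \<open>e\<^sub>n\<close>.\<close>
  have 2: "identification k l \<in> ring_iso (phi_ring Quot J) (sym_ring (k + l))"
    unfolding ident JK by (rule h.FactRing_iso_set[OF to_sym_onto])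
  \<comment> \<open>Representatives of one coset differ by an element of the kernel, so the
    identification takes \<open>the_elem\<close> of a singleton.\<close>
  have coset: "g \<in> carrier phi_ring \<and> to_sym k l g = to_sym k l f"
    if "f \<in> carrier phi_ring" "g \<in> J +>\<^bsub>phi_ring\<^esub> f" for f g
    using that h.rcos_imp_homeq[of f g] a_r_coset_subset_G[OF J.a_subset, of f] unfolding JK by blast
  have ident_coset: "identification k l (J +>\<^bsub>phi_ring\<^esub> f) = to_sym k l f" if "f \<in> carrier phi_ring" for f
  proof -
    have "f \<in> J +>\<^bsub>phi_ring\<^esub> f" using that by (rule J.a_rcos_self)
    then have "to_sym k l ` (J +>\<^bsub>phi_ring\<^esub> f) = {to_sym k l f}"
      using coset[OF that] by blast
    then show ?thesis by (simp add: ident)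
  qed
  have 3: "to_fract (identification k l (quot_op phi_ring J T X)) =
      jacobi_op (k + l) (z' - of_nat k) (w' - of_nat l) (identification k l X)"
    if "X \<in> carrier (phi_ring Quot J)" for X
  proof -
    obtain f where f: "f \<in> carrier phi_ring" and X: "X = J +>\<^bsub>phi_ring\<^esub> f"
      using \<open>X \<in> carrier (phi_ring Quot J)\<close> by (auto simp: FactRing_def A_RCOSETS_def')
    \<comment> \<open>By the intertwining relation the image of \<open>T g\<close> depends only on
      that of \<open>g\<close>. So all cosets of \<open>T g\<close> coincide and
      \<open>the_elem\<close> in \<open>quot_op\<close> is applied to a singleton.\<close>
    have "J +>\<^bsub>phi_ring\<^esub> T g = J +>\<^bsub>phi_ring\<^esub> T f" if "g \<in> X" for g
    proof -
      have g: "g \<in> carrier phi_ring" "to_sym k l g = to_sym k l f"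
        using coset[OF f] that by (auto simp: X)
      then have "to_sym k l (T g) = to_sym k l (T f)"
        using T[OF f] T[OF g(1)] by (metis to_fract_eq_iff)
      then have "T g \<in> J +>\<^bsub>phi_ring\<^esub> T f"
        unfolding JK by (intro h.homeq_imp_rcos T_closed f g)
      then show ?thesis
        using J.a_repr_independence' T_closed[OF f] by blast
    qed
    moreover have "f \<in> X" unfolding X using f by (rule J.a_rcos_self)
    ultimately have "(\<lambda>g. J +>\<^bsub>phi_ring\<^esub> T g) ` X = {J +>\<^bsub>phi_ring\<^esub> T f}"
      by blast
    then have "quot_op phi_ring J T X = J +>\<^bsub>phi_ring\<^esub> T f"
      by (simp add: quot_op_def)
    then show ?thesis
      by (simp add: X ident_coset f T_closed T)
  qed
  show ?thesis
    using 1 2 3 unfolding J_def T_def by blast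
qed

end
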